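(* Let $S$ be a SAT problem (a BMQ-SAT or CNF-SAT problem) of $n$ variables and $m$ equations, and let $B$ denote its bandwidth on a variable order. (i) If $S$ is BMQ, we can decide the satisfiability of $S$ in time $O(2^{B}(m+n)n^2)$. (ii) If $S$ is CNF, we can decide the satisfiability of $S$ in time $O(2^{B}(m+n))$.
   Context: $\mathbb{F}_2=\{0,1\}$ is the two-element field. The Boolean polynomial ring is $\mathbb{BP}_n=\mathbb{F}_2[x_1,\ldots,x_n]/(x_1^2+x_1,\ldots,x_n^2+x_n)$. A system $S(p_1,\ldots,p_m)$ is the system of equations $p_1=\cdots=p_m=0$ with $p_i\in\mathbb{BP}_n$; it is satisfiable if it has a solution in $\mathbb{F}_2^n$. Its degree is $\max_i\deg(p_i)$. A literal is $x_i$ or $x_i+1$ (the negation of $x_i$). A clause polynomial is $0$, $1$, or a product $l_1\cdots l_k$ ($k\ge1$) of literals with $l_a\notin\{l_b,l_b+1\}$ for $a\neq b$. A CNF-SAT problem of $n$ variables and $m$ equations is a system $S(c_1,\ldots,c_m)$ in which every $c_i$ is a clause polynomial (the equation $(y_1+\alpha_1)\cdots(y_k+\alpha_k)=0$, with $y_i$ variables and $\alpha_i\in\mathbb{F}_2$, corresponds to the disjunctive clause in which $y_i$ is negated if $\alpha_i=0$ and not negated if $\alpha_i=1$). A BMQ-SAT problem is a system of Boolean polynomial equations of degree $2$ (so each polynomial has degree at most $2$). Variables are ordered by subscript. The bandwidth of $S(p_1,\ldots,p_m)$ on the variable order is $B=\max_i\{\pi_{\max}(p_i)-\pi_{\min}(p_i)\}$,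 where $\pi_{\min}(p)$ and $\pi_{\max}(p)$ are the subscripts of the minimum and maximum variables appearing in $p$, both equal to $n+1$ if $p$ is constant. Cost conventions: polynomials are given as sums of clauses (in the BMQ case, as sums of monomials); a clause is stored as a hash set ($\emptyset$ for $0$, $\{1\}$ for $1$, and $\{l_1,\ldots,l_k\}$ for $l_1\cdots l_k$); search and delete in a hash set cost $O(1)$; for a set $\mathcal{P}$ of Boolean polynomials, computing $\mathcal{N}(\mathcal{P})$ (equal to $\{1\}$ if $1\in\mathcal{P}$ and to $\mathcal{P}\setminus\{0\}$ otherwise) is considered to cost $O(1)$; binary operations on $\mathbb{F}_2$ cost $O(1)$. *)

theory Defs
  imports Main "HOL-Library.FSet" "HOL-Library.FuncSet" "HOL-Library.Disjoint_Sets" "HOL-Library.Poly_Mapping" "HOL-Library.Z2"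
begin

section \<open>Boolean polynomials\<close>

text \<open>
  The Boolean polynomial ring is realised as the monoid algebra over \<^typ>\<open>bit\<close> (the field with two
  elements) of the monoid of finite sets of variables under union: a set stands for the product of its
  elements, so \<open>x\<^sub>i * x\<^sub>i = x\<^sub>i\<close>, and an element of the algebra is the reduced form (a sum of distinct
  squarefree monomials) of the corresponding class modulo the \<open>x\<^sub>i\<^sup>2 + x\<^sub>i\<close>. Multiplication is the
  convolution product of \<^theory>\<open>HOL-Library.Poly_Mapping\<close>.
\<close>

datatype monomial = Mon (mvars: "nat fset")

instantiation monomial :: comm_monoid_add
begin
definition "0 = Mon {||}"
definition "a + b = Mon (mvars a |\<union>| mvars b)"
instance
  by standard (auto simp: zero_monomial_def plus_monomial_def)
end

type_synonym bpoly = "monomial \<Rightarrow>\<^sub>0 bit"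

definition X :: "nat \<Rightarrow> bpoly" where
  "X i = Poly_Mapping.single (Mon {|i|}) 1"

definition mon :: "monomial \<Rightarrow> bpoly" where
  "mon u = Poly_Mapping.single u 1"

definition pvars :: "bpoly \<Rightarrow> nat set" where
  "pvars p = (\<Union>u\<in>Poly_Mapping.keys p. fset (mvars u))"

definition BP :: "nat \<Rightarrow> bpoly set" where
  "BP n = {p. pvars p \<subseteq> {1..n}}"

definition deg :: "bpoly \<Rightarrow> nat" where
  "deg p = Max (insert 0 ((\<lambda>u. fcard (mvars u)) ` Poly_Mapping.keys p))"

definition peval :: "(nat \<Rightarrow> bit) \<Rightarrow> bpoly \<Rightarrow> bit" where
  "peval a p = (\<Sum>u\<in>Poly_Mapping.keys p. Poly_Mapping.lookup p u * (\<Prod>i\<in>fset (mvars u). a i))"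

lemma X_square: "X i ^ 2 + X i = 0"
proof -
  have "Poly_Mapping.single v (1::bit) + Poly_Mapping.single v 1 = 0" for v :: monomial
    by (simp flip: single_add)
  then show ?thesis
    by (simp add: X_def power2_eq_square mult_single plus_monomial_def)
qed

lemma mon_eq_prod: "mon (Mon A) = (\<Prod>i\<in>fset A. X i)"
proof (induction A)
  case empty
  show ?case by (simp add: mon_def flip: zero_monomial_def)
next
  case (insert i A)
  have "mon (Mon (finsert i A)) = X i * mon (Mon A)"
    by (simp add: mon_def X_def mult_single plus_monomial_def)
  with insert show ?case by simp
qed

lemma bpoly_eq_sum_mon: "p = (\<Sum>u\<in>Poly_Mapping.keys p. mon u)" for p :: bpoly
proof (rule poly_mapping_eqI)
  fix v
  have "Poly_Mapping.lookup (\<Sum>u\<in>Poly_Mapping.keys p. mon u) v =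
    (\<Sum>u\<in>Poly_Mapping.keys p. if u = v then 1 else 0)"
    unfolding lookup_sum mon_def by (intro sum.cong) (auto simp: lookup_single when_def)
  also have "\<dots> = (if v \<in> Poly_Mapping.keys p then 1 else 0)"
    by simp
  also have "\<dots> = Poly_Mapping.lookup p v"
    by (auto simp: in_keys_iff)
  finally show "Poly_Mapping.lookup p v = Poly_Mapping.lookup (\<Sum>u\<in>Poly_Mapping.keys p. mon u) v" ..
qed


section \<open>Systems\<close>

definition satisfiable :: "nat \<Rightarrow> bpoly list \<Rightarrow> bool" where
  "satisfiable n ps \<longleftrightarrow> (\<exists>a\<in>{1..n} \<rightarrow>\<^sub>E UNIV. \<forall>p\<in>set ps. peval a p = 0)"

definition sys_degree :: "bpoly list \<Rightarrow> nat" where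
  "sys_degree ps = Max (insert 0 (deg ` set ps))"

text \<open>The pair \<open>(i, \<alpha>)\<close> stands for the literal \<open>x\<^sub>i + \<alpha>\<close>.\<close>

definition lit :: "nat \<times> bit \<Rightarrow> bpoly" where
  "lit l = X (fst l) + Poly_Mapping.single 0 (snd l)"

text \<open>Injectivity of the variable map on \<open>L\<close> says that no variable occurs in two literals.\<close>

definition clause_literals :: "nat \<Rightarrow> (nat \<times> bit) set \<Rightarrow> bool" where
  "clause_literals n L \<longleftrightarrow> finite L \<and> L \<noteq> {} \<and> fst ` L \<subseteq> {1..n} \<and> inj_on fst L"

definition clause_poly :: "nat \<Rightarrow> bpoly \<Rightarrow> bool" where
  "clause_poly n p \<longleftrightarrow> p = 0 \<or> p = 1 \<or> (\<exists>L. clause_literals n L \<and> p = (\<Prod>l\<in>L. lit l))"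

definition bmq_sat :: "nat \<Rightarrow> bpoly list \<Rightarrow> bool" where
  "bmq_sat n ps \<longleftrightarrow> set ps \<subseteq> BP n \<and> sys_degree ps \<le> 2"

definition cnf_sat :: "nat \<Rightarrow> bpoly list \<Rightarrow> bool" where
  "cnf_sat n ps \<longleftrightarrow> (\<forall>p\<in>set ps. clause_poly n p)"

text \<open>
  A variable order is given by the permutation \<open>ord\<close> that sends \<open>i\<close> to the position of \<open>x\<^sub>i\<close>;
  the order by subscript is the identity.
\<close>

definition variable_order :: "nat \<Rightarrow> (nat \<Rightarrow> nat) \<Rightarrow> bool" where
  "variable_order n ord \<longleftrightarrow> bij_betw ord {1..n} {1..n}"

definition pi_min :: "nat \<Rightarrow> (nat \<Rightarrow> nat) \<Rightarrow> bpoly \<Rightarrow> nat" where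
  "pi_min n ord p = (if pvars p = {} then n + 1 else Min (ord ` pvars p))"

definition pi_max :: "nat \<Rightarrow> (nat \<Rightarrow> nat) \<Rightarrow> bpoly \<Rightarrow> nat" where
  "pi_max n ord p = (if pvars p = {} then n + 1 else Max (ord ` pvars p))"

text \<open>The inserted \<open>0\<close> only matters for the system without equations.\<close>

definition bandwidth :: "nat \<Rightarrow> (nat \<Rightarrow> nat) \<Rightarrow> bpoly list \<Rightarrow> nat" where
  "bandwidth n ord ps = Max (insert 0 ((\<lambda>p. pi_max n ord p - pi_min n ord p) ` set ps))"


section \<open>Machine model\<close>

text \<open>
  A random access machine with finitely many registers and arrays of natural numbers and a heap of
  hash sets, programmed in a while language. A hash set is addressed by a number (its handle) and
  contains numbers: codes of literals for a clause, handles of clauses for a polynomial (a sum of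
  clauses), handles of polynomials for a set of polynomials. Every operation, including search,
  insertion and deletion in a hash set and the normalisation \<open>\<N>\<close> of a set of polynomials, has cost 1.
  Words are unbounded, but there is no operation, such as multiplication or a shift by many places, that makes
  them grow faster than addition does.
\<close>

record store =
  reg :: "nat \<Rightarrow> nat"
  arr :: "nat \<Rightarrow> nat \<Rightarrow> nat"
  hset :: "nat \<Rightarrow> nat set"

text \<open>\<open>Add2\<close> and \<open>Mul2\<close> are the operations of the two-element field.\<close>

datatype binop = Plus | Minus | Less | Equal | Add2 | Mul2

fun binop_val :: "binop \<Rightarrow> nat \<Rightarrow> nat \<Rightarrow> nat" where
  "binop_val Plus a b = a + b"
| "binop_val Minus a b = a - b"
| "binop_val Less a b = of_bool (a < b)"
| "binop_val Equal a b = of_bool (a = b)"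
| "binop_val Add2 a b = (a + b) mod 2"
| "binop_val Mul2 a b = (a * b) mod 2"

datatype expr =
    Const nat
  | Reg nat
  | Arr nat expr
  | Half expr
  | Bin binop expr expr
  | Search expr expr
  | Empty expr
  | Pick expr

text \<open>
  \<^term>\<open>Arr a e\<close> reads array \<open>a\<close> (a fixed number in the program text) at index \<open>e\<close>;
  \<^term>\<open>Search h e\<close> tests membership of \<open>e\<close> in the hash set with handle \<open>h\<close>; \<^term>\<open>Pick h\<close> yields
  some element of it. Which element is picked depends on the implementation of hash sets, here the
  parameter \<open>sel\<close>, about which a program may assume nothing but \<open>picker\<close>.
\<close>

definition picker :: "(nat set \<Rightarrow> nat) \<Rightarrow> bool" where
  "picker sel \<longleftrightarrow> (\<forall>A. finite A \<and> A \<noteq> {} \<longrightarrow> sel A \<in> A)"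

fun val :: "(nat set \<Rightarrow> nat) \<Rightarrow> store \<Rightarrow> expr \<Rightarrow> nat" where
  "val sel s (Const k) = k"
| "val sel s (Reg x) = reg s x"
| "val sel s (Arr a e) = arr s a (val sel s e)"
| "val sel s (Half e) = val sel s e div 2"
| "val sel s (Bin f e1 e2) = binop_val f (val sel s e1) (val sel s e2)"
| "val sel s (Search h e) = of_bool (val sel s e \<in> hset s (val sel s h))"
| "val sel s (Empty h) = of_bool (hset s (val sel s h) = {})"
| "val sel s (Pick h) = sel (hset s (val sel s h))"

fun cost :: "expr \<Rightarrow> nat" where
  "cost (Const k) = 1"
| "cost (Reg x) = 1"
| "cost (Arr a e) = 1 + cost e"
| "cost (Half e) = 1 + cost e"
| "cost (Bin f e1 e2) = 1 + cost e1 + cost e2"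
| "cost (Search h e) = 1 + cost h + cost e"
| "cost (Empty h) = 1 + cost h"
| "cost (Pick h) = 1 + cost h"

text \<open>Codes inside a clause: \<open>1\<close> for the constant \<open>1\<close>, and \<open>2 i + \<alpha>\<close> for the literal \<open>x\<^sub>i + \<alpha>\<close>.\<close>

definition lit_code :: "nat \<times> bit \<Rightarrow> nat" where
  "lit_code l = 2 * fst l + of_bool (snd l = 1)"

definition code_poly :: "nat \<Rightarrow> bpoly" where
  "code_poly k = (if k < 2 then of_nat k else lit (k div 2, of_nat k))"

definition clause_value :: "nat set \<Rightarrow> bpoly" where
  "clause_value A = (if A = {} then 0 else \<Prod>k\<in>A. code_poly k)"

definition poly_value :: "(nat \<Rightarrow> nat set) \<Rightarrow> nat \<Rightarrow> bpoly" where
  "poly_value H p = (\<Sum>c\<in>H p. clause_value (H c))"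

text \<open>On polynomials this is \<open>\<N>(P) = {1}\<close> if \<open>1 \<in> P\<close> and \<open>\<N>(P) = P - {0}\<close> otherwise.\<close>

definition normalise :: "(nat \<Rightarrow> nat set) \<Rightarrow> nat set \<Rightarrow> nat set" where
  "normalise H P = (if \<exists>p\<in>P. poly_value H p = 1 then {p\<in>P. poly_value H p = 1}
                    else {p\<in>P. poly_value H p \<noteq> 0})"

datatype com =
    Skip
  | Assign nat expr
  | Write nat expr expr
  | Insert expr expr
  | Delete expr expr
  | Normalise expr
  | Seq com com
  | If expr com com
  | While expr com

text \<open>\<open>exec sel c s t s'\<close>: started in \<open>s\<close>, the program \<open>c\<close> terminates in \<open>s'\<close> at cost \<open>t\<close>.\<close>

inductive exec :: "(nat set \<Rightarrow> nat) \<Rightarrow> com \<Rightarrow> store \<Rightarrow> nat \<Rightarrow> store \<Rightarrow> bool" for sel where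
  Skip: "exec sel Skip s 1 s"
| Assign: "exec sel (Assign x e) s (1 + cost e) (s\<lparr>reg := (reg s)(x := val sel s e)\<rparr>)"
| Write: "exec sel (Write a i e) s (1 + cost i + cost e)
    (s\<lparr>arr := (arr s)(a := (arr s a)(val sel s i := val sel s e))\<rparr>)"
| Insert: "exec sel (Insert h e) s (1 + cost h + cost e)
    (s\<lparr>hset := (hset s)(val sel s h := insert (val sel s e) (hset s (val sel s h)))\<rparr>)"
| Delete: "exec sel (Delete h e) s (1 + cost h + cost e)
    (s\<lparr>hset := (hset s)(val sel s h := hset s (val sel s h) - {val sel s e})\<rparr>)"
| Normalise: "exec sel (Normalise h) s (1 + cost h)
    (s\<lparr>hset := (hset s)(val sel s h := normalise (hset s) (hset s (val sel s h)))\<rparr>)"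
| Seq: "exec sel c1 s t1 s' \<Longrightarrow> exec sel c2 s' t2 s'' \<Longrightarrow> exec sel (Seq c1 c2) s (t1 + t2) s''"
| IfTrue: "val sel s b \<noteq> 0 \<Longrightarrow> exec sel c1 s t s' \<Longrightarrow> exec sel (If b c1 c2) s (1 + cost b + t) s'"
| IfFalse: "val sel s b = 0 \<Longrightarrow> exec sel c2 s t s' \<Longrightarrow> exec sel (If b c1 c2) s (1 + cost b + t) s'"
| WhileFalse: "val sel s b = 0 \<Longrightarrow> exec sel (While b c) s (1 + cost b) s"
| WhileTrue: "val sel s b \<noteq> 0 \<Longrightarrow> exec sel c s t1 s' \<Longrightarrow> exec sel (While b c) s' t2 s'' \<Longrightarrow>
    exec sel (While b c) s (1 + cost b + t1 + t2) s''"

inductive_cases exec_SeqE: "exec sel (Seq c1 c2) s t s'"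
inductive_cases exec_IfE: "exec sel (If b c1 c2) s t s'"
inductive_cases exec_WhileE: "exec sel (While b c) s t s'"

lemma exec_deterministic:
  "exec sel c s t s1 \<Longrightarrow> exec sel c s u s2 \<Longrightarrow> t = u \<and> s1 = s2"
proof (induction arbitrary: u s2 rule: exec.induct)
  case (Seq c1 s t1 s' c2 t2 s'')
  from Seq.prems obtain v1 r v2 where
    "exec sel c1 s v1 r" "exec sel c2 r v2 s2" "u = v1 + v2"
    by (rule exec_SeqE)
  with Seq.IH show ?case by blast
next
  case (IfTrue s b c1 t s' c2)
  from IfTrue.prems IfTrue.hyps(1) obtain v where "exec sel c1 s v s2" "u = 1 + cost b + v"
    by (cases rule: exec_IfE) auto
  with IfTrue.IH show ?case by blast
next
  case (IfFalse s b c2 t s' c1)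
  from IfFalse.prems IfFalse.hyps(1) obtain v where "exec sel c2 s v s2" "u = 1 + cost b + v"
    by (cases rule: exec_IfE) auto
  with IfFalse.IH show ?case by blast
next
  case (WhileFalse s b c)
  from WhileFalse.prems WhileFalse.hyps show ?case
    by (cases rule: exec_WhileE) auto
next
  case (WhileTrue s b c t1 s' t2 s'')
  from WhileTrue.prems WhileTrue.hyps(1) obtain v1 r v2 where
    "exec sel c s v1 r" "exec sel (While b c) r v2 s2" "u = 1 + cost b + v1 + v2"
    by (cases rule: exec_WhileE) auto
  with WhileTrue.IH show ?case by blast
qed (erule exec.cases; simp)+


section \<open>Inputs and deciding a problem in a given time\<close>

definition stores_clause :: "nat \<Rightarrow> nat set \<Rightarrow> bpoly \<Rightarrow> bool" where
  "stores_clause n A p \<longleftrightarrow>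
     (p = 0 \<and> A = {}) \<or> (p = 1 \<and> A = {1}) \<or>
     (\<exists>L. clause_literals n L \<and> p = (\<Prod>l\<in>L. lit l) \<and> A = lit_code ` L)"

text \<open>
  The summands by which a polynomial is given: its monomials in the BMQ case; in the CNF case every
  polynomial is a single clause.
\<close>

definition monomial_summands :: "bpoly \<Rightarrow> bpoly set" where
  "monomial_summands p = mon ` Poly_Mapping.keys p"

definition clause_summands :: "bpoly \<Rightarrow> bpoly set" where
  "clause_summands p = {p}"

definition stores_sum :: "nat \<Rightarrow> (nat \<Rightarrow> nat set) \<Rightarrow> nat set \<Rightarrow> bpoly set \<Rightarrow> bool" where
  "stores_sum n H K Q \<longleftrightarrow> (\<exists>g. bij_betw g K Q \<and> (\<forall>c\<in>K. stores_clause n (H c) (g c)))"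

text \<open>
  Registers 0, 1, 2 contain \<open>n\<close>, \<open>m\<close> and a bound on the handles in use, array 0 contains the variable
  order, and everything else is 0. The polynomials have the handles \<open>1, \<dots>, m\<close>, their set has handle 0,
  and no two of them share a clause in the heap.
\<close>

definition input_store ::
  "(bpoly \<Rightarrow> bpoly set) \<Rightarrow> nat \<Rightarrow> bpoly list \<Rightarrow> (nat \<Rightarrow> nat) \<Rightarrow> store \<Rightarrow> bool" where
  "input_store summands n ps ord s \<longleftrightarrow>
     (let m = length ps; u = reg s 2 in
        m < u \<and>
        reg s = (\<lambda>x. if x = 0 then n else if x = 1 then m else if x = 2 then u else 0) \<and>
        arr s = (\<lambda>a i. if a = 0 \<and> i \<in> {1..n} then ord i else 0) \<and>
        hset s 0 = {1..m} \<and>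
        (\<forall>j\<in>{1..m}. hset s j \<subseteq> {m<..<u} \<and> stores_sum n (hset s) (hset s j) (summands (ps ! (j - 1)))) \<and>
        disjoint_family_on (hset s) {1..m} \<and>
        (\<forall>h\<ge>u. hset s h = {}))"

text \<open>
  One program and one constant serve all numbers of variables, systems of the class, variable orders,
  implementations of hash sets and layouts of the input. The program is not told the bandwidth. The
  answer is returned in register 0.
\<close>

definition decidable_in_time ::
  "(nat \<Rightarrow> bpoly list \<Rightarrow> bool) \<Rightarrow> (bpoly \<Rightarrow> bpoly set) \<Rightarrow> (nat \<Rightarrow> nat \<Rightarrow> nat \<Rightarrow> nat) \<Rightarrow> bool" where
  "decidable_in_time problem summands f \<longleftrightarrow>
     (\<exists>prog C. \<forall>n ps ord sel s.
        n \<ge> 1 \<and> problem n ps \<and> variable_order n ord \<and> picker sel \<and> input_store summands n ps ord s \<longrightarrow>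
        (\<exists>t s'. exec sel prog s t s' \<and>
           reg s' 0 = of_bool (satisfiable n ps) \<and>
           t \<le> C * f (bandwidth n ord ps) (length ps) n))"

end

(*
  Bucket the equations by the position of their last variable and sweep over the positions e,
  keeping for each of the 2^(B+1) values of the window of the last B+1 variables the information
  whether it extends to a solution of the equations seen so far: moving the window drops its oldest
  variable, and then the equations of bucket e, which only involve variables of the window, rule out
  further values. The truth table of a clause over the window is computed in time O(2^B) by doubling:
  the next variable splits the table into two halves, each of which keeps or annihilates the old one
  according to which of the two literals of the variable occurs in the clause. A clause contains
  O(2^B) literals, so the time is O(2^B (m + n + N)) with N the total number of clauses. In the CNF
  case N = m, and a polynomial of degree at most 2 is a sum of at most 2 n^2 monomials, each of which is a clause.
*)
theory Submission
  imports Defs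
begin

section \<open>Evaluation of Boolean polynomials\<close>

text \<open>A flag says that a window fails, not that it extends, because arrays start as 0: before
  the first position every window is admissible without initialisation. Each move of the window
  writes a fresh block of flags, since entry \<open>M\<close> reads the old entries
  \<open>M div 2\<close> and \<open>M div 2 + 2 ^ bw\<close>, which an update in place would
  overwrite. Windows hold B + 1 positions because an equation of spread B touches up to that many;
  the extra factor 2 goes into the constant. Testing a clause literal by literal at every mask could
  cost a factor B + 1 too much; with doubling the costs form a geometric sum. The bandwidth is not
  part of the input, so the program measures the spread \<open>bw\<close> of the stored literals.
  Correctness is proved for \<open>bw\<close> itself, and the time bound then follows from
  \<open>bw \<le> bandwidth n ord ps\<close>. All of this takes place in a locale that knows only
  sets of codes; an equation is there the parity of the number of its clauses with value 1, and
  polynomials enter only at the end.\<close>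

lemma peval_superset:
  assumes "finite A" "Poly_Mapping.keys p \<subseteq> A"
  shows "peval a p = (\<Sum>u\<in>A. Poly_Mapping.lookup p u * (\<Prod>i\<in>fset (mvars u). a i))"
  unfolding peval_def using assms
  by (intro sum.mono_neutral_left) (auto simp: in_keys_iff)

lemma peval_zero [simp]: "peval a 0 = 0"
  by (simp add: peval_def)

lemma peval_add [simp]: "peval a (p + q) = peval a p + peval a q"
proof -
  let ?A = "Poly_Mapping.keys p \<union> Poly_Mapping.keys q"
  have "Poly_Mapping.keys (p + q) \<subseteq> ?A"
    by (rule Poly_Mapping.keys_add)
  then show ?thesis
    by (simp only: peval_superset[of ?A] finite_Un finite_keys Un_upper1 Un_upper2
        lookup_add distrib_right sum.distrib)
qed

lemma peval_sum: "peval a (\<Sum>x\<in>A. f x) = (\<Sum>x\<in>A. peval a (f x))"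
  by (induction A rule: infinite_finite_induct) auto

lemma peval_mon [simp]: "peval a (mon u) = (\<Prod>i\<in>fset (mvars u). a i)"
proof -
  have "Poly_Mapping.keys (mon u) = {u}" "Poly_Mapping.lookup (mon u) u = 1"
    by (simp_all add: mon_def)
  then show ?thesis
    by (simp only: peval_def sum.insert_if sum.empty finite.emptyI empty_iff if_False mult_1 add_0_right)
qed

lemma peval_one [simp]: "peval a 1 = 1"
proof -
  have "peval a 1 = peval a (mon 0)"
    unfolding mon_def single_one ..
  also have "\<dots> = 1"
    unfolding peval_mon zero_monomial_def by simp
  finally show ?thesis .
qed

text \<open>Over the two-element field a product is a conjunction, which makes idempotence of the
  factors visible.\<close>

lemma prod_bit:
  fixes f :: "'a \<Rightarrow> bit"
  assumes "finite A"
  shows "(\<Prod>i\<in>A. f i) = of_bool (\<forall>i\<in>A. f i = 1)"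
  using assms
proof induction
  case empty
  show ?case by simp
next
  case (insert x A)
  have all: "(\<forall>i\<in>insert x A. f i = 1) \<longleftrightarrow> f x = 1 \<and> (\<forall>i\<in>A. f i = 1)"
    by blast
  have fx: "of_bool (f x = 1) = f x"
    by (cases "f x") simp_all
  have "of_bool (\<forall>i\<in>insert x A. f i = 1) = of_bool (f x = 1) * (of_bool (\<forall>i\<in>A. f i = 1) :: bit)"
    unfolding all by (rule of_bool_conj)
  then show ?case
    unfolding prod.insert[OF insert.hyps] insert.IH fx by (rule sym)
qed

lemma mon_mult: "mon u * mon v = mon (u + v)"
  unfolding mon_def mult_single mult_1 ..

text \<open>A variable common to \<open>u\<close> and \<open>v\<close> is counted once on the left
  and twice on the right; reading the products as conjunctions makes the repetition
  harmless.\<close>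

lemma peval_mon_mult: "peval a (mon u * mon v) = peval a (mon u) * peval a (mon v)"
proof -
  have union: "(\<Prod>i\<in>A \<union> B. a i) = (\<Prod>i\<in>A. a i) * (\<Prod>i\<in>B. a i)" if "finite A" "finite B" for A B
  proof -
    have "(\<Prod>i\<in>A \<union> B. a i) = of_bool ((\<forall>i\<in>A. a i = 1) \<and> (\<forall>i\<in>B. a i = 1))"
      unfolding prod_bit[OF finite_UnI[OF that]] ball_Un ..
    also have "\<dots> = (\<Prod>i\<in>A. a i) * (\<Prod>i\<in>B. a i)"
      unfolding prod_bit[OF that(1)] prod_bit[OF that(2)] by (rule of_bool_conj)
    finally show ?thesis .
  qed
  show ?thesis
    unfolding mon_mult peval_mon plus_monomial_def monomial.sel union_fset
    by (rule union[OF finite_fset finite_fset])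
qed

lemma peval_mult [simp]: "peval a (p * q) = peval a p * peval a q"
proof -
  have "p * q = (\<Sum>u\<in>Poly_Mapping.keys p. \<Sum>v\<in>Poly_Mapping.keys q. mon u * mon v)"
    by (subst bpoly_eq_sum_mon[of p], subst bpoly_eq_sum_mon[of q]) (rule sum_product)
  then have "peval a (p * q) =
      (\<Sum>u\<in>Poly_Mapping.keys p. \<Sum>v\<in>Poly_Mapping.keys q. peval a (mon u) * peval a (mon v))"
    by (simp only: peval_sum peval_mon_mult)
  also have "\<dots> = (\<Sum>u\<in>Poly_Mapping.keys p. peval a (mon u)) * (\<Sum>v\<in>Poly_Mapping.keys q. peval a (mon v))"
    by (rule sum_product[symmetric])
  also have "\<dots> = peval a p * peval a q"
    by (simp only: flip: peval_sum bpoly_eq_sum_mon)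
  finally show ?thesis .
qed

lemma peval_prod: "peval a (\<Prod>x\<in>A. f x) = (\<Prod>x\<in>A. peval a (f x))"
  by (induction A rule: infinite_finite_induct) auto

lemma peval_lit [simp]: "peval a (lit l) = a (fst l) + snd l"
proof -
  have "Poly_Mapping.single 0 b = of_bool (b = 1)" for b :: bit
    by (cases b) simp_all
  then have "peval a (Poly_Mapping.single 0 (snd l)) = snd l"
    by (cases "snd l") simp_all
  moreover have "peval a (X (fst l)) = a (fst l)"
    using peval_mon[of a "Mon {|fst l|}"] by (simp add: mon_def X_def)
  ultimately show ?thesis by (simp add: lit_def)
qed

lemma peval_cong: "(\<And>i. i \<in> pvars p \<Longrightarrow> a i = b i) \<Longrightarrow> peval a p = peval b p"
proof -
  assume ab: "\<And>i. i \<in> pvars p \<Longrightarrow> a i = b i"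
  have "(\<Prod>i\<in>fset (mvars u). a i) = (\<Prod>i\<in>fset (mvars u). b i)" if "u \<in> Poly_Mapping.keys p" for u
  proof (rule prod.cong[OF refl])
    fix i assume "i \<in> fset (mvars u)"
    with that have "i \<in> pvars p" unfolding pvars_def by blast
    then show "a i = b i" by (rule ab)
  qed
  then show ?thesis
    unfolding peval_def by (intro sum.cong[OF refl] arg_cong2[of _ _ _ _ "(*)"] refl)
qed

lemma peval_clause:
  assumes "finite L"
  shows "peval a (\<Prod>l\<in>L. lit l) = of_bool (\<forall>l\<in>L. a (fst l) \<noteq> snd l)"
proof -
  have sum_eq_1: "x + y = 1 \<longleftrightarrow> x \<noteq> y" for x y :: bit
    by (simp only: Z2.bit_eq_iff even_add odd_one simp_thms)
  have "(\<forall>l\<in>L. a (fst l) + snd l = 1) \<longleftrightarrow> (\<forall>l\<in>L. a (fst l) \<noteq> snd l)"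
    by (rule ball_cong[OF refl sum_eq_1])
  then show ?thesis
    unfolding peval_prod peval_lit prod_bit[OF assms] by (rule arg_cong)
qed

text \<open>Occurrence is proved by sensitivity, since the expanded form of the product is not at
  hand: from an assignment \<open>a\<close> that gives every literal the value 1, setting variable
  \<open>i\<close> to \<open>b\<close> kills the literal \<open>(i, b)\<close> and changes the value
  of the product. \<open>inj_on\<close> guarantees that such an \<open>a\<close> exists. The
  inclusion later confines stored literals to the variables that the bandwidth counts.\<close>

lemma pvars_clause:
  assumes "clause_literals n L"
  shows "fst ` L \<subseteq> pvars (\<Prod>l\<in>L. lit l)"
proof
  fix i assume "i \<in> fst ` L"
  then obtain b where ib: "(i, b) \<in> L" by auto
  from assms have fin: "finite L" and inj: "inj_on fst L"
    by (auto simp: clause_literals_def)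
  define a :: "nat \<Rightarrow> bit" where "a v = of_bool ((v, 0) \<in> L)" for v
  have a: "a (fst l) \<noteq> snd l" if "l \<in> L" for l
  proof (cases "snd l")
    case zero
    with that have "(fst l, 0) \<in> L"
      by (metis prod.collapse)
    with zero show ?thesis by (simp add: a_def)
  next
    case one
    with that inj have "(fst l, 0) \<notin> L"
      by (metis fst_conv inj_onD snd_conv zero_neq_one)
    with one show ?thesis by (simp add: a_def)
  qed
  show "i \<in> pvars (\<Prod>l\<in>L. lit l)"
  proof (rule ccontr)
    assume "i \<notin> pvars (\<Prod>l\<in>L. lit l)"
    then have "peval a (\<Prod>l\<in>L. lit l) = peval (a(i := b)) (\<Prod>l\<in>L. lit l)"
      by (intro peval_cong) auto
    moreover have "\<forall>l\<in>L. a (fst l) \<noteq> snd l"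
      using a by blast
    moreover have "\<not> (\<forall>l\<in>L. (a(i := b)) (fst l) \<noteq> snd l)"
      using ib by (auto intro: bexI[of _ "(i, b)"])
    ultimately show False
      by (simp only: peval_clause[OF fin]) simp
  qed
qed

text \<open>The clause polynomial has the value 1, so an equation consisting of one clause that
  holds is a failing equation. The empty set stands for 0, hence \<open>A \<noteq> {}\<close>; the
  code 1 stands for the constant and must not be read as a literal of a variable 0.\<close>

definition holds :: "(nat \<Rightarrow> bool) \<Rightarrow> nat set \<Rightarrow> bool" where
  "holds a A \<longleftrightarrow> A \<noteq> {} \<and> (\<forall>k\<in>A. k = 1 \<or> a (k div 2) \<noteq> odd k)"

lemma ball_image: "(\<forall>y\<in>f ` A. P y) \<longleftrightarrow> (\<forall>x\<in>A. P (f x))"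
  by blast

lemma lit_code_simps [simp]:
  "lit_code l div 2 = fst l" "odd (lit_code l) \<longleftrightarrow> snd l = 1"
  by (auto simp: lit_code_def)

lemma bit_neq_iff: "x \<noteq> y \<longleftrightarrow> (x = 1) \<noteq> (y = 1)" for x y :: bit
  by (simp only: Z2.bit_eq_iff odd_one simp_thms)

text \<open>Variables are numbered from 1, so literal codes are at least 2 and never clash with the
  code 1 of the constant.\<close>

lemma stores_clause_lits:
  assumes "clause_literals n L" "A = lit_code ` L"
  shows "A \<noteq> {}" "finite A" "\<forall>k\<in>A. k \<noteq> 1 \<and> k div 2 \<in> {1..n}"
proof -
  from assms show "A \<noteq> {}" "finite A" by (simp_all add: clause_literals_def)
  show "\<forall>k\<in>A. k \<noteq> 1 \<and> k div 2 \<in> {1..n}"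
    unfolding assms(2) ball_image lit_code_simps
  proof
    fix l assume "l \<in> L"
    then have "fst l \<in> {1..n}"
      using assms(1) unfolding clause_literals_def by blast
    then show "lit_code l \<noteq> 1 \<and> fst l \<in> {1..n}"
      by (simp add: lit_code_def)
  qed
qed

lemma peval_stores_clause:
  assumes "stores_clause n A p"
  shows "peval a p = of_bool (holds (\<lambda>i. a i = 1) A)"
proof -
  consider "p = 0" "A = {}" | "p = 1" "A = {1}"
    | L where "clause_literals n L" "p = (\<Prod>l\<in>L. lit l)" "A = lit_code ` L"
    using assms unfolding stores_clause_def by blast
  then show ?thesis
  proof cases
    case 3
    then have L: "finite L" by (simp add: clause_literals_def)
    have "holds (\<lambda>i. a i = 1) A \<longleftrightarrow> (\<forall>k\<in>A. (a (k div 2) = 1) \<noteq> odd k)"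
      using stores_clause_lits[OF 3(1,3)] unfolding holds_def by blast
    also have "\<dots> \<longleftrightarrow> (\<forall>l\<in>L. (a (fst l) = 1) \<noteq> (snd l = 1))"
      unfolding 3(3) ball_image lit_code_simps ..
    also have "\<dots> \<longleftrightarrow> (\<forall>l\<in>L. a (fst l) \<noteq> snd l)"
      by (rule ball_cong[OF refl bit_neq_iff[symmetric]])
    finally show ?thesis
      unfolding 3(2) peval_clause[OF L] by (rule arg_cong[OF sym])
  qed (simp_all add: holds_def)
qed

lemma stores_clause_codes:
  assumes "stores_clause n A p" "pvars p \<subseteq> V"
  shows "finite A" "\<forall>k\<in>A. k = 1 \<or> k div 2 \<in> {1..n} \<inter> V"
proof -
  consider "A = {}" | "A = {1}"
    | L where "clause_literals n L" "p = (\<Prod>l\<in>L. lit l)" "A = lit_code ` L"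
    using assms(1) unfolding stores_clause_def by blast
  then have "finite A \<and> (\<forall>k\<in>A. k = 1 \<or> k div 2 \<in> {1..n} \<inter> V)"
  proof cases
    case 3
    have "k div 2 \<in> V" if "k \<in> A" for k
    proof -
      from that obtain l where l: "l \<in> L" "k = lit_code l"
        unfolding 3(3) by blast
      then have "fst l \<in> pvars p"
        using pvars_clause[OF 3(1)] unfolding 3(2) by blast
      with assms(2) show ?thesis
        unfolding l(2) lit_code_simps by blast
    qed
    with stores_clause_lits[OF 3(1,3)] show ?thesis by blast
  qed simp_all
  then show "finite A" "\<forall>k\<in>A. k = 1 \<or> k div 2 \<in> {1..n} \<inter> V"
    by blast+
qed

section \<open>Monomials of a polynomial of degree at most 2\<close>

lemma inj_mon: "inj mon"
  by (rule injI) (metis keys_single mon_def singleton_inject zero_neq_one)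

lemma pvars_mon: "u \<in> Poly_Mapping.keys p \<Longrightarrow> pvars (mon u) \<subseteq> pvars p"
  by (auto simp: pvars_def mon_def)

lemma sum_monomial_summands: "(\<Sum>q\<in>monomial_summands p. q) = p"
proof -
  have "(\<Sum>q\<in>monomial_summands p. q) = (\<Sum>u\<in>Poly_Mapping.keys p. mon u)"
    unfolding monomial_summands_def using inj_on_subset[OF inj_mon]
    by (subst sum.reindex) auto
  then show ?thesis by (simp flip: bpoly_eq_sum_mon)
qed

text \<open>Pairs \<open>(i, k)\<close> with \<open>i = k\<close> allowed cover degrees 1 and 2 at
  once, and the unit monomial adds 1; \<open>n \<ge> 1\<close> bounds \<open>1 + n^2\<close> by
  \<open>2 * n^2\<close>.\<close>

lemma card_monomial_summands:
  assumes "n \<ge> 1" "p \<in> BP n" "deg p \<le> 2"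
  shows "card (monomial_summands p) \<le> 2 * n\<^sup>2"
proof -
  let ?P = "(\<lambda>(i, k). Mon {|i, k|}) ` ({1..n} \<times> {1..n})"
  have "u \<in> insert 0 ?P" if u: "u \<in> Poly_Mapping.keys p" for u
  proof -
    have "fcard (mvars u) \<le> deg p"
      unfolding deg_def using u by (intro Max_ge) auto
    with assms have "card (fset (mvars u)) \<le> 2" by (simp add: fcard.rep_eq)
    then have "card (fset (mvars u)) = 0 \<or> card (fset (mvars u)) = 1 \<or> card (fset (mvars u)) = 2"
      by linarith
    then consider "fset (mvars u) = {}" | i k where "fset (mvars u) = {i, k}"
      by (auto simp: card_1_singleton_iff card_2_iff)
    then show ?thesis
    proof cases
      case 1
      then have "u = 0" by (cases u) (simp add: zero_monomial_def fset_inject[symmetric])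
      then show ?thesis by simp
    next
      case 2
      then have "u = Mon {|i, k|}" by (cases u) (simp add: fset_inject[symmetric])
      moreover have "{i, k} \<subseteq> pvars p"
        using u 2 by (auto simp: pvars_def)
      then have "{i, k} \<subseteq> {1..n}"
        using assms(2) by (auto simp: BP_def)
      ultimately show ?thesis by force
    qed
  qed
  then have "card (Poly_Mapping.keys p) \<le> card (insert 0 ?P)"
    by (intro card_mono) auto
  also have "\<dots> \<le> 1 + card ?P"
    by (simp add: card_insert_if)
  also have "card ?P \<le> n\<^sup>2"
    using card_image_le[of "{1..n} \<times> {1..n}"] by (simp add: power2_eq_square)
  also have "1 + n\<^sup>2 \<le> 2 * n\<^sup>2"
    using assms(1) by simp
  finally show ?thesis
    unfolding monomial_summands_def using card_image_le[of "Poly_Mapping.keys p" mon] by simp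
qed

section \<open>Reasoning about programs\<close>

text \<open>Total correctness with the cost passed to the postcondition: a time bound in
  \<open>Q\<close> includes termination.\<close>

definition runs :: "(nat set \<Rightarrow> nat) \<Rightarrow> com \<Rightarrow> store \<Rightarrow> (nat \<Rightarrow> store \<Rightarrow> bool) \<Rightarrow> bool" where
  "runs sel c s Q \<longleftrightarrow> (\<exists>t s'. exec sel c s t s' \<and> Q t s')"

lemma runsI: "exec sel c s t s' \<Longrightarrow> Q t s' \<Longrightarrow> runs sel c s Q"
  by (auto simp: runs_def)

lemma runs_mono:
  "runs sel c s P \<Longrightarrow> (\<And>t s'. P t s' \<Longrightarrow> Q t s') \<Longrightarrow> runs sel c s Q"
  by (auto simp: runs_def)

lemma runs_Skip: "Q 1 s \<Longrightarrow> runs sel Skip s Q"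
  by (rule runsI, rule exec.Skip)

lemma runs_Assign:
  "Q (1 + cost e) (s\<lparr>reg := (reg s)(x := val sel s e)\<rparr>) \<Longrightarrow> runs sel (Assign x e) s Q"
  by (rule runsI, rule exec.Assign)

lemma runs_Write:
  "Q (1 + cost i + cost e) (s\<lparr>arr := (arr s)(a := (arr s a)(val sel s i := val sel s e))\<rparr>) \<Longrightarrow>
   runs sel (Write a i e) s Q"
  by (rule runsI, rule exec.Write)

lemma runs_Insert:
  "Q (1 + cost h + cost e)
     (s\<lparr>hset := (hset s)(val sel s h := insert (val sel s e) (hset s (val sel s h)))\<rparr>) \<Longrightarrow>
   runs sel (Insert h e) s Q"
  by (rule runsI, rule exec.Insert)

lemma runs_Delete:
  "Q (1 + cost h + cost e)
     (s\<lparr>hset := (hset s)(val sel s h := hset s (val sel s h) - {val sel s e})\<rparr>) \<Longrightarrow>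
   runs sel (Delete h e) s Q"
  by (rule runsI, rule exec.Delete)

lemma runs_Seq:
  "runs sel c1 s (\<lambda>t s'. runs sel c2 s' (\<lambda>t'. Q (t + t'))) \<Longrightarrow> runs sel (Seq c1 c2) s Q"
  by (auto simp: runs_def intro: exec.Seq)

lemma runs_If:
  "(val sel s b \<noteq> 0 \<Longrightarrow> runs sel c1 s (\<lambda>t. Q (1 + cost b + t))) \<Longrightarrow>
   (val sel s b = 0 \<Longrightarrow> runs sel c2 s (\<lambda>t. Q (1 + cost b + t))) \<Longrightarrow> runs sel (If b c1 c2) s Q"
  unfolding runs_def by (cases "val sel s b = 0") (meson exec.IfTrue exec.IfFalse)+

lemmas runs_intros = runs_Seq runs_Skip runs_Assign runs_Write runs_Insert runs_Delete runs_If

text \<open>\<open>p\<close> is the remaining time budget and part of the invariant. Every round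
  consumes at least \<open>1 + cost b\<close>, so the budget is its own termination measure.\<close>

lemma runs_While:
  assumes "I p s"
    and exit: "\<And>p s. I p s \<Longrightarrow> val sel s b = 0 \<Longrightarrow> 1 + cost b \<le> p \<and> Q s"
    and step: "\<And>p s. I p s \<Longrightarrow> val sel s b \<noteq> 0 \<Longrightarrow>
      runs sel c s (\<lambda>t s'. \<exists>p'. I p' s' \<and> 1 + cost b + t + p' \<le> p)"
  shows "runs sel (While b c) s (\<lambda>t s'. t \<le> p \<and> Q s')"
  using assms(1)
proof (induction p arbitrary: s rule: less_induct)
  case (less p)
  show ?case
  proof (cases "val sel s b = 0")
    case True
    with exit[OF less.prems] show ?thesis
      by (auto intro: runsI exec.WhileFalse)
  next
    case False
    with step[OF less.prems] obtain t s' p' where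
      c: "exec sel c s t s'" "I p' s'" "1 + cost b + t + p' \<le> p"
      by (auto simp: runs_def)
    with less.IH[of p' s'] obtain t' s'' where
      "exec sel (While b c) s' t' s''" "t' \<le> p'" "Q s''"
      by (auto simp: runs_def)
    with runsI[OF exec.WhileTrue[OF False c(1) this(1)]] c(3) show ?thesis
      by simp
  qed
qed

definition For :: "nat \<Rightarrow> expr \<Rightarrow> com \<Rightarrow> com" where
  "For x e c = Seq (Assign x (Const 0))
     (While (Bin Less (Reg x) e) (Seq c (Assign x (Bin Plus (Reg x) (Const 1)))))"

text \<open>Per round the test costs \<open>3 + cost e\<close> and the increment 4; initialisation
  and the final test give \<open>5 + cost e\<close>. The bound \<open>e\<close> is evaluated anew in
  each round, so the invariant has to keep its value at \<open>N\<close>.\<close>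

lemma runs_For:
  fixes T :: "nat \<Rightarrow> nat"
  assumes init: "I 0 (s\<lparr>reg := (reg s)(x := 0)\<rparr>)"
    and bound: "\<And>i s. i \<le> N \<Longrightarrow> I i s \<Longrightarrow> reg s x = i \<and> val sel s e = N"
    and step: "\<And>i s. i < N \<Longrightarrow> I i s \<Longrightarrow> runs sel c s
      (\<lambda>t s'. t \<le> T i \<and> reg s' x = i \<and> I (Suc i) (s'\<lparr>reg := (reg s')(x := Suc i)\<rparr>))"
  shows "runs sel (For x e c) s (\<lambda>t s'. t \<le> (\<Sum>i<N. T i) + N * (7 + cost e) + 5 + cost e \<and> I N s')"
proof -
  define p where "p i = (\<Sum>k=i..<N. T k + (7 + cost e)) + 3 + cost e" for i
  have p_Suc: "p i = T i + (7 + cost e) + p (Suc i)" if "i < N" for i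
    using that by (simp add: p_def sum.atLeast_Suc_lessThan)
  have "runs sel (While (Bin Less (Reg x) e) (Seq c (Assign x (Bin Plus (Reg x) (Const 1)))))
      (s\<lparr>reg := (reg s)(x := 0)\<rparr>) (\<lambda>t s'. t \<le> p 0 \<and> I N s')"
  proof (rule runs_While[where I = "\<lambda>q s. \<exists>i\<le>N. q = p i \<and> I i s"])
    show "\<exists>i\<le>N. p 0 = p i \<and> I i (s\<lparr>reg := (reg s)(x := 0)\<rparr>)"
      using init by blast
  next
    fix q s assume "\<exists>i\<le>N. q = p i \<and> I i s" and ex: "val sel s (Bin Less (Reg x) e) = 0"
    then obtain i where i: "i \<le> N" "q = p i" "I i s" by blast
    with ex bound[OF i(1,3)] have "i = N" by simp
    with i show "1 + cost (Bin Less (Reg x) e) \<le> q \<and> I N s"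
      by (simp add: p_def)
  next
    fix q s assume "\<exists>i\<le>N. q = p i \<and> I i s" and ex: "val sel s (Bin Less (Reg x) e) \<noteq> 0"
    then obtain i where i: "i \<le> N" "q = p i" "I i s" by blast
    with ex bound[OF i(1,3)] have "i < N" by simp
    have "runs sel c s (\<lambda>t s'. runs sel (Assign x (Bin Plus (Reg x) (Const 1))) s'
      (\<lambda>t' s'. \<exists>p'. (\<exists>i\<le>N. p' = p i \<and> I i s') \<and> 1 + cost (Bin Less (Reg x) e) + (t + t') + p' \<le> q))"
    proof (rule runs_mono[OF step[OF \<open>i < N\<close> i(3)]])
      fix t s' assume *: "t \<le> T i \<and> reg s' x = i \<and> I (Suc i) (s'\<lparr>reg := (reg s')(x := Suc i)\<rparr>)"
      then have "\<exists>p'. (\<exists>k\<le>N. p' = p k \<and> I k (s'\<lparr>reg := (reg s')(x := Suc i)\<rparr>)) \<and>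
          1 + cost (Bin Less (Reg x) e) + (t + (1 + cost (Bin Plus (Reg x) (Const 1)))) + p' \<le> q"
        using \<open>i < N\<close> i(2) p_Suc[of i]
        by (intro exI[of _ "p (Suc i)"] conjI exI[of _ "Suc i"]) auto
      with * show "runs sel (Assign x (Bin Plus (Reg x) (Const 1))) s'
          (\<lambda>t' s'. \<exists>p'. (\<exists>i\<le>N. p' = p i \<and> I i s') \<and> 1 + cost (Bin Less (Reg x) e) + (t + t') + p' \<le> q)"
        by (intro runs_Assign) simp
    qed
    then show "runs sel (Seq c (Assign x (Bin Plus (Reg x) (Const 1)))) s
      (\<lambda>t s'. \<exists>p'. (\<exists>i\<le>N. p' = p i \<and> I i s') \<and> 1 + cost (Bin Less (Reg x) e) + t + p' \<le> q)"
      by (rule runs_Seq)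
  qed
  moreover have "p 0 = (\<Sum>i<N. T i) + N * (7 + cost e) + 3 + cost e"
    by (simp add: p_def sum.distrib atLeast0LessThan)
  ultimately show ?thesis
    unfolding For_def by (intro runs_Seq runs_Assign) (auto elim!: runs_mono)
qed

definition Drain :: "expr \<Rightarrow> nat \<Rightarrow> com \<Rightarrow> com" where
  "Drain h x c = While (Bin Equal (Empty h) (Const 0))
     (Seq (Assign x (Pick h)) (Seq (Delete h (Reg x)) c))"

text \<open>The order of enumeration depends on the unknown \<open>sel\<close>, so the invariant is
  indexed by the set \<open>E\<close> of elements still to come and each step must work for any
  \<open>y\<close> in \<open>E\<close>. Test, pick and deletion cost \<open>4 + cost h\<close>,
  \<open>2 + cost h\<close> and \<open>2 + cost h\<close>. \<open>indep\<close> keeps the handle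
  fixed while register \<open>x\<close> receives the element.\<close>

lemma runs_Drain:
  fixes T :: "nat \<Rightarrow> nat"
  assumes sel: "picker sel" and fin: "finite D" and init: "I D s"
    and handle: "\<And>E s. E \<subseteq> D \<Longrightarrow> I E s \<Longrightarrow> hset s (val sel s h) = E"
    and indep: "\<And>s y. val sel (s\<lparr>reg := (reg s)(x := y)\<rparr>) h = val sel s h"
    and step: "\<And>E s y. E \<subseteq> D \<Longrightarrow> y \<in> E \<Longrightarrow> I E s \<Longrightarrow>
      runs sel c (s\<lparr>reg := (reg s)(x := y), hset := (hset s)(val sel s h := E - {y})\<rparr>)
        (\<lambda>t s'. t \<le> T y \<and> I (E - {y}) s')"
  shows "runs sel (Drain h x c) s
    (\<lambda>t s'. t \<le> (\<Sum>y\<in>D. T y) + card D * (8 + 3 * cost h) + 4 + cost h \<and> I {} s')"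
proof -
  define p where "p E = (\<Sum>y\<in>E. T y + (8 + 3 * cost h)) + 4 + cost h" for E
  have p_remove: "p E = T y + (8 + 3 * cost h) + p (E - {y})" if "E \<subseteq> D" "y \<in> E" for E y
    using that finite_subset[OF that(1) fin] by (simp add: p_def sum.remove)
  have "runs sel (Drain h x c) s (\<lambda>t s'. t \<le> p D \<and> I {} s')"
    unfolding Drain_def
  proof (rule runs_While[where I = "\<lambda>q s. \<exists>E\<subseteq>D. q = p E \<and> I E s"])
    show "\<exists>E\<subseteq>D. p D = p E \<and> I E s"
      using init by blast
  next
    fix q s assume "\<exists>E\<subseteq>D. q = p E \<and> I E s" and ex: "val sel s (Bin Equal (Empty h) (Const 0)) = 0"
    then obtain E where E: "E \<subseteq> D" "q = p E" "I E s" by blast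
    with ex handle[OF E(1,3)] have "E = {}" by (simp split: if_splits)
    with E show "1 + cost (Bin Equal (Empty h) (Const 0)) \<le> q \<and> I {} s"
      by (simp add: p_def)
  next
    fix q s assume "\<exists>E\<subseteq>D. q = p E \<and> I E s" and ex: "val sel s (Bin Equal (Empty h) (Const 0)) \<noteq> 0"
    then obtain E where E: "E \<subseteq> D" "q = p E" "I E s" by blast
    note hE = handle[OF E(1,3)]
    with ex have "E \<noteq> {}" by (auto split: if_splits)
    with sel finite_subset[OF E(1) fin] have y: "sel E \<in> E" by (auto simp: picker_def)
    show "runs sel (Seq (Assign x (Pick h)) (Seq (Delete h (Reg x)) c)) s
       (\<lambda>t s'. \<exists>p'. (\<exists>E\<subseteq>D. p' = p E \<and> I E s') \<and> 1 + cost (Bin Equal (Empty h) (Const 0)) + t + p' \<le> q)"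
    proof (intro runs_Seq runs_Assign runs_Delete)
      have "runs sel c (s\<lparr>reg := (reg s)(x := sel E), hset := (hset s)(val sel s h := E - {sel E})\<rparr>)
          (\<lambda>t s'. \<exists>p'. (\<exists>E\<subseteq>D. p' = p E \<and> I E s') \<and> 1 + cost (Bin Equal (Empty h) (Const 0)) +
            (1 + cost (Pick h) + (1 + cost h + cost (Reg x) + t)) + p' \<le> q)"
      proof (rule runs_mono[OF step[OF E(1) y E(3)]])
        fix t s' assume *: "t \<le> T (sel E) \<and> I (E - {sel E}) s'"
        have "E - {sel E} \<subseteq> D" using E(1) by blast
        with * E(2) p_remove[OF E(1) y]
        show "\<exists>p'. (\<exists>E\<subseteq>D. p' = p E \<and> I E s') \<and> 1 + cost (Bin Equal (Empty h) (Const 0)) +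
            (1 + cost (Pick h) + (1 + cost h + cost (Reg x) + t)) + p' \<le> q"
          by (intro exI[of _ "p (E - {sel E})"] conjI exI[of _ "E - {sel E}"]) auto
      qed
      then show "runs sel c
          ((s\<lparr>reg := (reg s)(x := val sel s (Pick h))\<rparr>)
            \<lparr>hset := (hset (s\<lparr>reg := (reg s)(x := val sel s (Pick h))\<rparr>))
              (val sel (s\<lparr>reg := (reg s)(x := val sel s (Pick h))\<rparr>) h :=
                hset (s\<lparr>reg := (reg s)(x := val sel s (Pick h))\<rparr>)
                  (val sel (s\<lparr>reg := (reg s)(x := val sel s (Pick h))\<rparr>) h) -
                {val sel (s\<lparr>reg := (reg s)(x := val sel s (Pick h))\<rparr>) (Reg x)})\<rparr>)
          (\<lambda>t s'. \<exists>p'. (\<exists>E\<subseteq>D. p' = p E \<and> I E s') \<and> 1 + cost (Bin Equal (Empty h) (Const 0)) +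
            (1 + cost (Pick h) + (1 + cost h + cost (Reg x) + t)) + p' \<le> q)"
        by (simp add: indep hE)
    qed
  qed
  moreover have "p D = (\<Sum>y\<in>D. T y) + card D * (8 + 3 * cost h) + 4 + cost h"
    by (simp add: p_def sum.distrib)
  ultimately show ?thesis by simp
qed

section \<open>Dynamic programming over windows of variables\<close>

text \<open>What is left of an input once polynomials are forgotten: \<open>H\<close> sends the
  handles 1 to \<open>m\<close> to sets of clause handles, and these to sets of codes. Clause
  handles exceed \<open>m\<close>, so the two roles do not mix. Disjointness ensures that emptying
  the clauses of one polynomial leaves those of the others intact.\<close>

locale clause_system =
  fixes n m u :: nat and ord :: "nat \<Rightarrow> nat" and H :: "nat \<Rightarrow> nat set"
  assumes ord: "bij_betw ord {1..n} {1..n}"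
    and m_less: "m < u"
    and clauses: "\<And>j. j \<in> {1..m} \<Longrightarrow> H j \<subseteq> {m<..<u}"
    and disjoint: "disjoint_family_on H {1..m}"
    and codes: "\<And>j c. j \<in> {1..m} \<Longrightarrow> c \<in> H j \<Longrightarrow>
      finite (H c) \<and> (\<forall>k\<in>H c. k = 1 \<or> k div 2 \<in> {1..n})"
begin

definition lits :: "nat \<Rightarrow> nat set" where
  "lits j = (\<Union>c\<in>H j. H c - {1})"

definition place :: "nat \<Rightarrow> nat" where
  "place k = ord (k div 2)"

text \<open>With the default 0 here and \<open>n + 1\<close> in \<open>lo\<close>, a constant
  equation has spread 0 by truncated subtraction and is treated at position 0.\<close>

definition hi :: "nat \<Rightarrow> nat" where
  "hi j = Max (insert 0 (place ` lits j))"

definition lo :: "nat \<Rightarrow> nat" where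
  "lo j = Min (insert (n + 1) (place ` lits j))"

definition bw :: nat where
  "bw = Max (insert 0 ((\<lambda>j. hi j - lo j) ` {1..m}))"

text \<open>\<open>n + 1\<close> is not a variable, so that its literals occur in no clause (unlike the code \<open>2 * 0 + 1\<close>).\<close>

definition var_at :: "nat \<Rightarrow> nat" where
  "var_at p = (if p \<in> {1..n} then inv_into {1..n} ord p else n + 1)"

text \<open>The value of the clause when only the first \<open>i\<close> bits of the mask are taken
  into account; bit \<open>k\<close> is here the variable at position \<open>e - k\<close>. A bit 1
  kills the literal with code \<open>2 * v + 1\<close> (the negated one), a bit 0 the one with code
  \<open>2 * v\<close>.\<close>

definition table :: "nat \<Rightarrow> nat \<Rightarrow> nat \<Rightarrow> nat \<Rightarrow> bool" where
  "table e c i M \<longleftrightarrow> H c \<noteq> {} \<and>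
     (\<forall>k<i. if bit M k then 2 * var_at (e - k) + 1 \<notin> H c else 2 * var_at (e - k) \<notin> H c)"

text \<open>A sum over the two-element field is 1 if an odd number of its clauses have value 1. The
  mask is read as for \<open>bad (Suc e)\<close>.\<close>

definition violated :: "nat \<Rightarrow> nat \<Rightarrow> nat \<Rightarrow> bool" where
  "violated e j M \<longleftrightarrow> odd (card {c \<in> H j. table e c (bw + 1) M})"

text \<open>
  Bit \<open>k\<close> of a mask \<open>M\<close> is the value of the variable at position \<open>e - 1 - k\<close>, so that \<open>bad e M\<close> says
  that no assignment of the variables at positions below \<open>e\<close> with this window solves all equations
  in these variables. Positions \<open>\<le> 0\<close> carry dummy variables.
\<close>

primrec bad :: "nat \<Rightarrow> nat \<Rightarrow> bool" where
  "bad 0 M \<longleftrightarrow> False"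
| "bad (Suc e) M \<longleftrightarrow> (bad e (M div 2) \<and> bad e (M div 2 + 2 ^ bw)) \<or>
     (\<exists>j\<in>{1..m}. hi j = e \<and> violated e j M)"

lemma finite_clauses: "j \<in> {1..m} \<Longrightarrow> finite (H j)"
  using clauses finite_subset by blast

lemma finite_lits: "j \<in> {1..m} \<Longrightarrow> finite (lits j)"
  unfolding lits_def using finite_clauses codes by blast

lemma lits_var: "j \<in> {1..m} \<Longrightarrow> k \<in> lits j \<Longrightarrow> k div 2 \<in> {1..n}"
  unfolding lits_def using codes by blast

lemma place_range: "j \<in> {1..m} \<Longrightarrow> k \<in> lits j \<Longrightarrow> place k \<in> {1..n}"
  unfolding place_def using lits_var ord by (auto simp: bij_betw_def)

lemma place_le_hi: "j \<in> {1..m} \<Longrightarrow> k \<in> lits j \<Longrightarrow> place k \<le> hi j"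
  unfolding hi_def using finite_lits by (intro Max_ge) auto

lemma lo_le_place: "j \<in> {1..m} \<Longrightarrow> k \<in> lits j \<Longrightarrow> lo j \<le> place k"
  unfolding lo_def using finite_lits by (intro Min_le) auto

lemma hi_le:
  assumes "j \<in> {1..m}"
  shows "hi j \<le> n"
proof -
  have "\<forall>x\<in>insert 0 (place ` lits j). x \<le> n"
    unfolding ball_simps ball_image using place_range[OF assms] by auto
  with finite_lits[OF assms] show ?thesis
    by (simp add: hi_def)
qed

lemma spread_le: "j \<in> {1..m} \<Longrightarrow> hi j - lo j \<le> bw"
  unfolding bw_def by (intro Max_ge) auto

lemma var_at_ord: "v \<in> {1..n} \<Longrightarrow> var_at (ord v) = v"
  using ord bij_betw_apply[OF ord, of v]
  by (simp add: var_at_def bij_betw_def inv_into_f_f)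

lemma ord_var_at: "p \<in> {1..n} \<Longrightarrow> ord (var_at p) = p"
  using ord f_inv_into_f[of p ord "{1..n}"] by (simp add: var_at_def bij_betw_def)

text \<open>\<open>f\<close> lists values by position, shifted by \<open>bw + 1\<close>, so that
  windows reaching below position 1 need no negative indices. All literals of an equation with last
  position \<open>e\<close> lie within \<open>bw\<close> below \<open>e\<close>, so the window
  decides the clause; positions without a variable impose nothing, because no clause contains a
  literal of \<open>n + 1\<close>.\<close>

lemma table_iff_holds:
  assumes j: "j \<in> {1..m}" "hi j = e" and c: "c \<in> H j"
    and f: "\<And>k. k \<le> bw \<Longrightarrow> f (e + 1 + bw - k) = bit M k"
  shows "table e c (bw + 1) M \<longleftrightarrow> holds (\<lambda>v. f (ord v + bw + 1)) (H c)"
proof (intro iffI)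
  assume tab: "table e c (bw + 1) M"
  have "f (ord (l div 2) + bw + 1) \<noteq> odd l" if l: "l \<in> H c" "l \<noteq> 1" for l
  proof -
    have lj: "l \<in> lits j" using l c by (auto simp: lits_def)
    \<comment> \<open>The offset of the literal in the window; the spread of the equation keeps it
      at most \<open>bw\<close>.\<close>
    define k where "k = e - place l"
    have k: "place l = e - k" "k \<le> e" "k \<le> bw"
      using place_le_hi[OF j(1) lj] lo_le_place[OF j(1) lj] spread_le[OF j(1)] j(2)
      by (auto simp: k_def)
    have v: "var_at (e - k) = l div 2"
      using var_at_ord[OF lits_var[OF j(1) lj]] k(1) by (simp add: place_def)
    have "ord (l div 2) + bw + 1 = e + 1 + bw - k"
      using k by (simp add: place_def)
    then have fk: "f (ord (l div 2) + bw + 1) = bit M k"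
      using f[OF k(3)] by simp
    have "if bit M k then 2 * (l div 2) + 1 \<notin> H c else 2 * (l div 2) \<notin> H c"
      using tab k(3) v unfolding table_def by (metis less_Suc_eq_le Suc_eq_plus1)
    then have "bit M k \<noteq> odd l"
      using l(1) by (cases "odd l") (auto split: if_splits)
    with fk show ?thesis by simp
  qed
  with tab show "holds (\<lambda>v. f (ord v + bw + 1)) (H c)"
    unfolding table_def holds_def by blast
next
  assume hol: "holds (\<lambda>v. f (ord v + bw + 1)) (H c)"
  have "if bit M k then 2 * var_at (e - k) + 1 \<notin> H c else 2 * var_at (e - k) \<notin> H c"
    if k: "k < bw + 1" for k
  proof (cases "e - k \<in> {1..n}")
    case True
    have "f (ord (var_at (e - k)) + bw + 1) = bit M k"
    proof -
      have "ord (var_at (e - k)) + bw + 1 = e + 1 + bw - k"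
        unfolding ord_var_at[OF True] using True unfolding atLeastAtMost_iff by arith
      then show ?thesis using f[of k] k by simp
    qed
    moreover have "var_at (e - k) \<ge> 1"
      using True ord inv_into_into[of "e - k" ord "{1..n}"] by (auto simp: var_at_def bij_betw_def)
    moreover have "f (ord (l div 2) + bw + 1) \<noteq> odd l" if "l \<in> H c" "l \<noteq> 1" for l
      using hol that unfolding holds_def by blast
    from this[of "2 * var_at (e - k)"] this[of "2 * var_at (e - k) + 1"]
    have "2 * var_at (e - k) \<in> H c \<Longrightarrow> f (ord (var_at (e - k)) + bw + 1)"
      "2 * var_at (e - k) + 1 \<in> H c \<Longrightarrow> var_at (e - k) \<ge> 1 \<Longrightarrow> \<not> f (ord (var_at (e - k)) + bw + 1)"
      by simp_all
    ultimately show ?thesis by auto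
  next
    case False
    then have v: "var_at (e - k) = n + 1" by (auto simp: var_at_def)
    have "2 * (n + 1) + b \<notin> H c" if "b < 2" for b
    proof
      assume "2 * (n + 1) + b \<in> H c"
      then have "(2 * (n + 1) + b) div 2 \<in> {1..n}"
        using codes[OF j(1) c] by fastforce
      with that show False by simp
    qed
    from this[of 0] this[of 1] show ?thesis unfolding v by simp
  qed
  with hol show "table e c (bw + 1) M"
    unfolding table_def holds_def by blast
qed

section \<open>Correctness of the recursion for bad windows\<close>

definition solves :: "(nat \<Rightarrow> bool) \<Rightarrow> nat \<Rightarrow> bool" where
  "solves a j \<longleftrightarrow> even (card {c \<in> H j. holds a (H c)})"

lemma violated_iff:
  assumes "j \<in> {1..m}" "hi j = e" "\<And>k. k \<le> bw \<Longrightarrow> f (e + 1 + bw - k) = bit M k"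
  shows "violated e j M \<longleftrightarrow> \<not> solves (\<lambda>v. f (ord v + bw + 1)) j"
proof -
  have "{c \<in> H j. table e c (bw + 1) M} = {c \<in> H j. holds (\<lambda>v. f (ord v + bw + 1)) (H c)}"
    using table_iff_holds[OF assms(1,2) _ assms(3)] by blast
  then show ?thesis by (simp add: violated_def solves_def)
qed

text \<open>Later positions may be reassigned without harm to an equation already treated; this is
  what allows the window to grow in \<open>bad_iff\<close>.\<close>

lemma solves_cong:
  assumes "j \<in> {1..m}" "\<And>v. v \<in> {1..n} \<Longrightarrow> ord v \<le> hi j \<Longrightarrow> a v = b v"
  shows "solves a j \<longleftrightarrow> solves b j"
proof -
  have "holds a (H c) \<longleftrightarrow> holds b (H c)" if c: "c \<in> H j" for c
  proof -
    have "(k = 1 \<or> a (k div 2) \<noteq> odd k) \<longleftrightarrow> (k = 1 \<or> b (k div 2) \<noteq> odd k)" if k: "k \<in> H c" for k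
    proof (cases "k = 1")
      case False
      with k c have "k \<in> lits j" by (auto simp: lits_def)
      then have "a (k div 2) = b (k div 2)"
        using assms lits_var place_le_hi by (simp add: place_def)
      then show ?thesis by simp
    qed simp
    then show ?thesis
      unfolding holds_def by (simp cong: ball_cong)
  qed
  then have "{c \<in> H j. holds a (H c)} = {c \<in> H j. holds b (H c)}" by blast
  then show ?thesis by (simp add: solves_def)
qed

text \<open>The two predecessors of window \<open>M\<close>: halving drops the newest variable, and
  \<open>b\<close> is the value of the oldest one, which \<open>M\<close> has forgotten.\<close>

lemma bit_shift:
  fixes M :: nat
  assumes "M < 2 ^ (bw + 1)" "k \<le> bw"
  shows "bit (M div 2 + of_bool b * 2 ^ bw) k \<longleftrightarrow> (if k = bw then b else bit M (Suc k))"
proof -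
  have lt: "M div 2 < 2 ^ bw" using assms(1) by simp
  show ?thesis
  proof (cases "k = bw")
    case True
    have "(M div 2 + of_bool b * 2 ^ bw) div 2 ^ bw = of_bool b"
      using lt by (cases b) (simp_all add: div_add_self2)
    with True show ?thesis by (simp add: bit_iff_odd)
  next
    case False
    with assms obtain d where d: "bw = k + Suc d"
      by (metis add_Suc_right le_neq_implies_less less_imp_Suc_add)
    have "(M div 2 + of_bool b * 2 ^ bw) div 2 ^ k = M div 2 div 2 ^ k + of_bool b * 2 ^ Suc d"
      unfolding d power_add by (cases b) (simp_all add: mult.commute)
    then have "bit (M div 2 + of_bool b * 2 ^ bw) k \<longleftrightarrow> odd (M div 2 div 2 ^ k + of_bool b * 2 ^ Suc d)"
      unfolding bit_iff_odd by (rule arg_cong)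
    also have "\<dots> \<longleftrightarrow> bit M (Suc k)"
      unfolding bit_Suc bit_iff_odd[of "M div 2"] by simp
    finally show ?thesis using False by simp
  qed
qed

text \<open>Induction on \<open>e\<close> with \<open>f\<close> as a full history of values. The
  recursion step forgets index \<open>e\<close> and adds index \<open>e + 1 + bw\<close>, which is
  position \<open>e\<close>; equations with \<open>hi j < e\<close> do not look at the latter, and
  those with \<open>hi j = e\<close> are decided by the window.\<close>

lemma bad_iff:
  assumes "M < 2 ^ (bw + 1)"
  shows "\<not> bad e M \<longleftrightarrow> (\<exists>f. (\<forall>k\<le>bw. f (e + bw - k) = bit M k) \<and>
    (\<forall>j\<in>{1..m}. hi j < e \<longrightarrow> solves (\<lambda>v. f (ord v + bw + 1)) j))"
  using assms
proof (induction e arbitrary: M)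
  case 0
  have "\<forall>k\<le>bw. bit M (bw - (0 + bw - k)) = bit M k" by simp
  then show ?case by (auto intro!: exI[of _ "\<lambda>i. bit M (bw - i)"])
next
  case (Suc e)
  have less: "M div 2 + of_bool b * 2 ^ bw < 2 ^ (bw + 1)" for b
    using Suc.prems by (cases b) auto
  have bad_Suc: "\<not> bad (Suc e) M \<longleftrightarrow> (\<exists>b. \<not> bad e (M div 2 + of_bool b * 2 ^ bw)) \<and>
      (\<forall>j\<in>{1..m}. hi j = e \<longrightarrow> \<not> violated e j M)"
    by (auto simp: ex_bool_eq)
  show ?case
  proof
    assume "\<not> bad (Suc e) M"
    then obtain b where b: "\<not> bad e (M div 2 + of_bool b * 2 ^ bw)"
      and viol: "\<And>j. j \<in> {1..m} \<Longrightarrow> hi j = e \<Longrightarrow> \<not> violated e j M"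
      unfolding bad_Suc by blast
    from b obtain f where f: "\<forall>k\<le>bw. f (e + bw - k) = bit (M div 2 + of_bool b * 2 ^ bw) k"
      and sol: "\<And>j. j \<in> {1..m} \<Longrightarrow> hi j < e \<Longrightarrow> solves (\<lambda>v. f (ord v + bw + 1)) j"
      unfolding Suc.IH[OF less] by blast
    \<comment> \<open>Bit 0 of \<open>M\<close> is the value at position \<open>e\<close>, the one
      position that is new to the window.\<close>
    define g where "g = f(e + 1 + bw := bit M 0)"
    have g: "g (e + 1 + bw - k) = bit M k" if "k \<le> bw" for k
    proof (cases k)
      case (Suc i)
      with that f have "f (e + bw - i) = bit M (Suc i)"
        by (auto simp: bit_shift[OF \<open>M < 2 ^ (bw + 1)\<close>])
      with Suc that show ?thesis by (auto simp: g_def)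
    qed (simp add: g_def)
    have "solves (\<lambda>v. g (ord v + bw + 1)) j" if j: "j \<in> {1..m}" "hi j < Suc e" for j
    proof (cases "hi j = e")
      case True
      with violated_iff[OF j(1) True, of g M] g viol[OF j(1) True] show ?thesis by blast
    next
      case False
      with j have "solves (\<lambda>v. f (ord v + bw + 1)) j" by (intro sol) auto
      also have "solves (\<lambda>v. f (ord v + bw + 1)) j = solves (\<lambda>v. g (ord v + bw + 1)) j"
        using j False by (intro solves_cong) (auto simp: g_def)
      finally show ?thesis .
    qed
    with g show "\<exists>f. (\<forall>k\<le>bw. f (Suc e + bw - k) = bit M k) \<and>
      (\<forall>j\<in>{1..m}. hi j < Suc e \<longrightarrow> solves (\<lambda>v. f (ord v + bw + 1)) j)"
      by (intro exI[of _ g]) auto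
  next
    assume "\<exists>f. (\<forall>k\<le>bw. f (Suc e + bw - k) = bit M k) \<and>
      (\<forall>j\<in>{1..m}. hi j < Suc e \<longrightarrow> solves (\<lambda>v. f (ord v + bw + 1)) j)"
    then obtain f where f': "\<forall>k\<le>bw. f (Suc e + bw - k) = bit M k"
      and sol: "\<And>j. j \<in> {1..m} \<Longrightarrow> hi j < Suc e \<Longrightarrow> solves (\<lambda>v. f (ord v + bw + 1)) j"
      by blast
    from f' have f: "\<And>k. k \<le> bw \<Longrightarrow> f (e + 1 + bw - k) = bit M k"
      by simp
    have "\<not> violated e j M" if "j \<in> {1..m}" "hi j = e" for j
      using violated_iff[of j e f M] that f sol by simp
    \<comment> \<open>Index \<open>e\<close> is the oldest of the preceding window, so
      \<open>f e\<close> tells which of the two predecessors to take.\<close>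
    moreover have "\<not> bad e (M div 2 + of_bool (f e) * 2 ^ bw)"
    proof -
      have "f (e + bw - k) = bit (M div 2 + of_bool (f e) * 2 ^ bw) k" if k: "k \<le> bw" for k
      proof (cases "k = bw")
        case False
        with k f[of "Suc k"] show ?thesis
          by (simp add: bit_shift[OF Suc.prems])
      qed (simp add: bit_shift[OF Suc.prems])
      with sol show ?thesis
        unfolding Suc.IH[OF less] by (intro exI[of _ f]) auto
    qed
    ultimately show "\<not> bad (Suc e) M"
      unfolding bad_Suc by blast
  qed
qed

lemma ex_mask: "\<exists>M<(2::nat) ^ N. \<forall>k<N. bit M k \<longleftrightarrow> P k"
proof (intro exI conjI allI impI)
  let ?M = "horner_sum of_bool 2 (map P [0..<N]) :: nat"
  show "?M < 2 ^ N"
    using horner_sum_of_bool_2_less[of "map P [0..<N]"] by simp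
  show "bit ?M k \<longleftrightarrow> P k" if "k < N" for k
    using that by (simp add: bit_horner_sum_bit_iff)
qed

text \<open>By \<open>hi_le\<close> no equation ends after position \<open>n\<close>, so at
  \<open>n + 1\<close> the invariant \<open>bad_iff\<close> speaks of all of them.\<close>

theorem dynamic_programming:
  "(\<exists>M<2 ^ (bw + 1). \<not> bad (n + 1) M) \<longleftrightarrow> (\<exists>a. \<forall>j\<in>{1..m}. solves a j)"
proof
  assume "\<exists>M<2 ^ (bw + 1). \<not> bad (n + 1) M"
  then obtain M where "M < 2 ^ (bw + 1)" "\<not> bad (n + 1) M" by blast
  then obtain f where "\<forall>j\<in>{1..m}. hi j < n + 1 \<longrightarrow> solves (\<lambda>v. f (ord v + bw + 1)) j"
    using bad_iff[of M "n + 1"] by blast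
  with hi_le have "\<forall>j\<in>{1..m}. solves (\<lambda>v. f (ord v + bw + 1)) j"
    by (simp add: le_imp_less_Suc)
  then show "\<exists>a. \<forall>j\<in>{1..m}. solves a j"
    by (rule exI[of _ "\<lambda>v. f (ord v + bw + 1)"])
next
  assume "\<exists>a. \<forall>j\<in>{1..m}. solves a j"
  then obtain a where a: "\<And>j. j \<in> {1..m} \<Longrightarrow> solves a j" by blast
  \<comment> \<open>This undoes the shift; truncated subtraction sends all missing positions to the
    dummy variable \<open>n + 1\<close>.\<close>
  define f where "f i = a (var_at (i - (bw + 1)))" for i
  obtain M :: nat where M: "M < 2 ^ (bw + 1)" "\<forall>k<bw+1. bit M k \<longleftrightarrow> f (n + 1 + bw - k)"
    using ex_mask[of "bw + 1" "\<lambda>k. f (n + 1 + bw - k)"] by blast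
  have "solves (\<lambda>v. f (ord v + bw + 1)) j" if j: "j \<in> {1..m}" for j
  proof -
    have "solves (\<lambda>v. f (ord v + bw + 1)) j = solves a j"
      using j by (intro solves_cong) (simp_all add: f_def var_at_ord)
    with a[OF j] show ?thesis by simp
  qed
  then have "\<not> bad (n + 1) M"
    unfolding bad_iff[OF M(1)] using M(2) by (intro exI[of _ f]) (simp add: less_Suc_eq_le)
  with M(1) show "\<exists>M<2 ^ (bw + 1). \<not> bad (n + 1) M" by blast
qed

end

section \<open>The program\<close>

text \<open>
  Registers: 3 to 7 are scratch for the preprocessing; 8 contains the bandwidth \<open>B\<close>, 9 and 10 contain
  \<open>2\<^sup>B\<^sup>+\<^sup>1\<close> and \<open>2\<^sup>B\<close>, 11 the current position, 12 the base of the current block of array 2, 13 and 14 the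
  current polynomial and clause, 15 to 17 a bit of a mask, its weight and its variable, 18 a mask.
  Arrays: 1 is the inverse of the variable order, 2 contains one block of \<open>2\<^sup>B\<^sup>+\<^sup>1\<close> flags per position (a flag
  is 1 if the window is bad), 3 and 4 are the truth tables of the current polynomial and clause.
  Hash sets: the contents of handle \<open>x < u\<close> are moved to \<open>x + u\<close>, because the only way to enumerate a set
  is to empty it; handle \<open>2 u + e\<close> collects the polynomials whose last variable has position \<open>e\<close>.
\<close>

abbreviation seq (infixr ";;" 60) where "c ;; d \<equiv> Seq c d"
abbreviation plus_expr (infixl "\<oplus>" 65) where "e \<oplus> f \<equiv> Bin Plus e f"
abbreviation minus_expr (infixl "\<ominus>" 65) where "e \<ominus> f \<equiv> Bin Minus e f"

text \<open>The upper half is written first, while entry \<open>x\<close> still has its old value,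
  which both products use. \<open>Const 1\<close> minus a search is the negated membership
  test.\<close>

definition halves :: com where
  "halves = For 18 (Reg 16)
     (Write 4 (Reg 18 \<oplus> Reg 16) (Bin Mul2 (Arr 4 (Reg 18))
        (Const 1 \<ominus> Search (Reg 14 \<oplus> Reg 2) (Reg 17 \<oplus> Reg 17 \<oplus> Const 1))) ;;
      Write 4 (Reg 18) (Bin Mul2 (Arr 4 (Reg 18))
        (Const 1 \<ominus> Search (Reg 14 \<oplus> Reg 2) (Reg 17 \<oplus> Reg 17))))"

definition clause_table :: com where
  "clause_table =
     Write 4 (Const 0) (Const 1 \<ominus> Empty (Reg 14 \<oplus> Reg 2)) ;;
     Assign 16 (Const 1) ;;
     For 15 (Reg 8 \<oplus> Const 1)
       (Assign 17 (Arr 1 (Reg 11 \<ominus> Reg 15)) ;; halves ;; Assign 16 (Reg 16 \<oplus> Reg 16))"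

definition add_table :: com where
  "add_table = For 18 (Reg 9) (Write 3 (Reg 18) (Bin Add2 (Arr 3 (Reg 18)) (Arr 4 (Reg 18))))"

text \<open>Clearing array 3 on the way leaves it ready for the next polynomial.\<close>

definition flush :: com where
  "flush = For 18 (Reg 9)
     (If (Arr 3 (Reg 18)) (Write 2 (Reg 12 \<oplus> Reg 18) (Const 1) ;; Write 3 (Reg 18) (Const 0)) Skip)"

definition poly_constraint :: com where
  "poly_constraint = Drain (Reg 13 \<oplus> Reg 2) 14 (clause_table ;; add_table) ;; flush"

text \<open>\<open>Mul2\<close> is the conjunction of two flags: a window fails only if both values
  of the dropped variable fail.\<close>

definition shift :: com where
  "shift = For 18 (Reg 9)
     (Write 2 (Reg 12 \<oplus> Reg 9 \<oplus> Reg 18)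
       (Bin Mul2 (Arr 2 (Reg 12 \<oplus> Half (Reg 18))) (Arr 2 (Reg 12 \<oplus> Half (Reg 18) \<oplus> Reg 10)))) ;;
     Assign 12 (Reg 12 \<oplus> Reg 9)"

definition sweep :: com where
  "sweep = For 11 (Reg 0 \<oplus> Const 1) (shift ;; Drain (Reg 2 \<oplus> Reg 2 \<oplus> Reg 11) 13 poly_constraint)"

definition answer :: com where
  "answer = Assign 0 (Const 0) ;; For 18 (Reg 9) (If (Arr 2 (Reg 12 \<oplus> Reg 18)) Skip (Assign 0 (Const 1)))"

text \<open>A frame condition: in the sweep, registers are numbered so that inner routines change
  only higher ones than those their callers rely on.\<close>

definition same_upto :: "nat \<Rightarrow> store \<Rightarrow> store \<Rightarrow> bool" where
  "same_upto k s s' \<longleftrightarrow> (\<forall>x<k. reg s' x = reg s x)"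

section \<open>Correctness and cost of the table operations\<close>

lemma runs_halves:
  assumes s: "reg s 16 = q" "reg s 17 = v" "hset s (reg s 14 + reg s 2) = C"
  shows "runs sel halves s (\<lambda>t s'. t \<le> 50 * q + 10 \<and> same_upto 18 s s' \<and> hset s' = hset s \<and>
    (\<forall>a. a \<noteq> 4 \<longrightarrow> arr s' a = arr s a) \<and>
    (\<forall>x<q. arr s' 4 x = (arr s 4 x * (1 - of_bool (2 * v \<in> C))) mod 2 \<and>
      arr s' 4 (x + q) = (arr s 4 x * (1 - of_bool (2 * v + 1 \<in> C))) mod 2))"
proof -
  define I where "I i s' \<longleftrightarrow> reg s' 18 = i \<and> same_upto 18 s s' \<and> hset s' = hset s \<and>
    (\<forall>a. a \<noteq> 4 \<longrightarrow> arr s' a = arr s a) \<and>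
    arr s' 4 = (\<lambda>x. if x < i then (arr s 4 x * (1 - of_bool (2 * v \<in> C))) mod 2
      else if q \<le> x \<and> x < q + i then (arr s 4 (x - q) * (1 - of_bool (2 * v + 1 \<in> C))) mod 2
      else arr s 4 x)" for i s'
  have "runs sel halves s (\<lambda>t s'. t \<le> (\<Sum>i<q. 35) + q * (7 + cost (Reg 16)) + 5 + cost (Reg 16) \<and> I q s')"
    unfolding halves_def
  proof (rule runs_For)
    show "I 0 (s\<lparr>reg := (reg s)(18 := 0)\<rparr>)"
      by (auto simp: I_def fun_eq_iff same_upto_def)
  next
    fix i s' assume "I i s'"
    then show "reg s' 18 = i \<and> val sel s' (Reg 16) = q"
      using s by (simp add: I_def same_upto_def)
  next
    fix i s' assume i: "i < q" and "I i s'"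
    then have r: "reg s' 18 = i" "\<And>x. x < 18 \<Longrightarrow> reg s' x = reg s x" and h: "hset s' = hset s"
      and a: "\<forall>a. a \<noteq> 4 \<longrightarrow> arr s' a = arr s a"
      and a4: "arr s' 4 = (\<lambda>x. if x < i then (arr s 4 x * (1 - of_bool (2 * v \<in> C))) mod 2
      else if q \<le> x \<and> x < q + i then (arr s 4 (x - q) * (1 - of_bool (2 * v + 1 \<in> C))) mod 2
      else arr s 4 x)"
      by (simp_all add: I_def same_upto_def)
    show "runs sel (Write 4 (Reg 18 \<oplus> Reg 16) (Bin Mul2 (Arr 4 (Reg 18))
          (Const 1 \<ominus> Search (Reg 14 \<oplus> Reg 2) (Reg 17 \<oplus> Reg 17 \<oplus> Const 1))) ;;
        Write 4 (Reg 18) (Bin Mul2 (Arr 4 (Reg 18))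
          (Const 1 \<ominus> Search (Reg 14 \<oplus> Reg 2) (Reg 17 \<oplus> Reg 17)))) s'
       (\<lambda>t s'. t \<le> 35 \<and> reg s' 18 = i \<and> I (Suc i) (s'\<lparr>reg := (reg s')(18 := Suc i)\<rparr>))"
      apply (intro runs_intros)
      using i
      apply (simp add: r h a4 s I_def same_upto_def a mult_2[symmetric])
      apply (auto simp: fun_eq_iff less_Suc_eq)
      done
  qed
  then show ?thesis
    by (rule runs_mono) (auto simp: I_def)
qed

lemma bit_below: "k < i \<Longrightarrow> bit (M + 2 ^ i) k = bit M k" for M :: nat
proof -
  assume "k < i"
  then obtain d where d: "i = k + Suc d"
    by (metis add_Suc_right less_imp_Suc_add)
  have "(M + 2 ^ i) div 2 ^ k = M div 2 ^ k + 2 ^ Suc d"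
    unfolding d power_add by simp
  then show ?thesis by (simp add: bit_iff_odd)
qed

lemma bit_top: "M < 2 ^ i \<Longrightarrow> \<not> bit M i" "M < 2 ^ i \<Longrightarrow> bit (M + 2 ^ i) i" for M :: nat
  by (simp_all add: bit_iff_odd div_add_self2)

lemma of_bool_mod_2 [simp]: "of_bool P mod 2 = (of_bool P :: nat)"
  by (cases P) simp_all

lemma of_bool_mult_mod: "(of_bool P * (1 - of_bool Q)) mod 2 = (of_bool (P \<and> \<not> Q) :: nat)"
  by (cases P; cases Q) simp_all

lemma of_bool_add_mod: "(of_bool P + of_bool Q) mod 2 = (of_bool (P \<noteq> Q) :: nat)"
  by (cases P; cases Q) simp_all

context clause_system
begin

abbreviation W :: nat where "W \<equiv> 2 ^ (bw + 1)"

text \<open>The doubling recurrence that \<open>halves\<close> implements: the two extensions of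
  \<open>M\<close> differ in bit \<open>i\<close>, hence in which literal of the next variable
  annihilates.\<close>

lemma table_Suc:
  assumes "M < 2 ^ i"
  shows "table e c (Suc i) M \<longleftrightarrow> table e c i M \<and> 2 * var_at (e - i) \<notin> H c"
    and "table e c (Suc i) (M + 2 ^ i) \<longleftrightarrow> table e c i M \<and> 2 * var_at (e - i) + 1 \<notin> H c"
  using assms bit_top[OF assms] by (auto simp: table_def less_Suc_eq bit_below)

lemma runs_clause_table:
  assumes s: "reg s 8 = bw" "reg s 11 = e" "e \<le> n" "hset s (reg s 14 + reg s 2) = H c"
    and inv: "\<forall>p\<le>n. arr s 1 p = var_at p"
  shows "runs sel clause_table s (\<lambda>t s'. t \<le> 200 * W \<and> same_upto 15 s s' \<and> hset s' = hset s \<and>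
    (\<forall>a. a \<noteq> 4 \<longrightarrow> arr s' a = arr s a) \<and> (\<forall>M<W. arr s' 4 M = of_bool (table e c (bw + 1) M)))"
proof -
  define I where "I i s' \<longleftrightarrow> reg s' 15 = i \<and> reg s' 16 = 2 ^ i \<and> same_upto 15 s s' \<and> hset s' = hset s \<and>
    (\<forall>a. a \<noteq> 4 \<longrightarrow> arr s' a = arr s a) \<and> (\<forall>M<2 ^ i. arr s' 4 M = of_bool (table e c i M))" for i s'
  let ?body = "Assign 17 (Arr 1 (Reg 11 \<ominus> Reg 15)) ;; halves ;; Assign 16 (Reg 16 \<oplus> Reg 16)"
  have loop: "runs sel (For 15 (Reg 8 \<oplus> Const 1) ?body) s0
      (\<lambda>t s'. t \<le> (\<Sum>i<bw + 1. 50 * 2 ^ i + 20) + (bw + 1) * (7 + cost (Reg 8 \<oplus> Const 1)) + 5 +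
        cost (Reg 8 \<oplus> Const 1) \<and> I (bw + 1) s')"
    if "I 0 (s0\<lparr>reg := (reg s0)(15 := 0)\<rparr>)" for s0
  proof (rule runs_For)
    show "I 0 (s0\<lparr>reg := (reg s0)(15 := 0)\<rparr>)" by (fact that)
  next
    fix i s' assume "I i s'"
    then show "reg s' 15 = i \<and> val sel s' (Reg 8 \<oplus> Const 1) = bw + 1"
      using s by (simp add: I_def same_upto_def)
  next
    fix i s' assume i: "i < bw + 1" and "I i s'"
    then have r: "reg s' 15 = i" "reg s' 16 = 2 ^ i" "\<And>x. x < 15 \<Longrightarrow> reg s' x = reg s x"
      and h: "hset s' = hset s" and a: "\<And>a. a \<noteq> 4 \<Longrightarrow> arr s' a = arr s a"
      and a4: "\<And>M. M < 2 ^ i \<Longrightarrow> arr s' 4 M = of_bool (table e c i M)"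
      by (simp_all add: I_def same_upto_def)
    have v: "arr s (Suc 0) (e - i) = var_at (e - i)" using inv s(3) by simp
    show "runs sel ?body s' (\<lambda>t s'. t \<le> 50 * 2 ^ i + 20 \<and> reg s' 15 = i \<and> I (Suc i) (s'\<lparr>reg := (reg s')(15 := Suc i)\<rparr>))"
    proof -
      let ?s1 = "s'\<lparr>reg := (reg s')(17 := val sel s' (Arr 1 (Reg 11 \<ominus> Reg 15)))\<rparr>"
      have "runs sel halves ?s1 (\<lambda>t s''. t \<le> 50 * 2 ^ i + 10 \<and> same_upto 18 ?s1 s'' \<and> hset s'' = hset ?s1 \<and>
        (\<forall>a. a \<noteq> 4 \<longrightarrow> arr s'' a = arr ?s1 a) \<and>
        (\<forall>x<2 ^ i. arr s'' 4 x = (arr ?s1 4 x * (1 - of_bool (2 * var_at (e - i) \<in> H c))) mod 2 \<and>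
          arr s'' 4 (x + 2 ^ i) = (arr ?s1 4 x * (1 - of_bool (2 * var_at (e - i) + 1 \<in> H c))) mod 2))"
        by (rule runs_halves) (use s in \<open>simp_all add: r h a v\<close>)
      then show ?thesis
      proof (intro runs_Seq runs_Assign, elim runs_mono, intro runs_Assign)
        fix t :: nat and s'' assume "t \<le> 50 * 2 ^ i + 10 \<and> same_upto 18 ?s1 s'' \<and> hset s'' = hset ?s1 \<and>
          (\<forall>a. a \<noteq> 4 \<longrightarrow> arr s'' a = arr ?s1 a) \<and>
          (\<forall>x<2 ^ i. arr s'' 4 x = (arr ?s1 4 x * (1 - of_bool (2 * var_at (e - i) \<in> H c))) mod 2 \<and>
            arr s'' 4 (x + 2 ^ i) = (arr ?s1 4 x * (1 - of_bool (2 * var_at (e - i) + 1 \<in> H c))) mod 2)"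
        then have t: "t \<le> 50 * 2 ^ i + 10" and r': "\<And>x. x < 18 \<Longrightarrow> x \<noteq> 17 \<Longrightarrow> reg s'' x = reg s' x"
          and h': "hset s'' = hset s" and a': "\<And>a. a \<noteq> 4 \<Longrightarrow> arr s'' a = arr s a"
          and a4': "\<And>x. x < 2 ^ i \<Longrightarrow> arr s'' 4 x = of_bool (table e c (Suc i) x)"
            "\<And>x. x < 2 ^ i \<Longrightarrow> arr s'' 4 (x + 2 ^ i) = of_bool (table e c (Suc i) (x + 2 ^ i))"
          by (simp_all add: h a same_upto_def a4 of_bool_mult_mod table_Suc del: of_bool_conj)
        have "arr s'' 4 M = of_bool (table e c (Suc i) M)" if M: "M < 2 ^ Suc i" for M
        proof (cases "M < 2 ^ i")
          case False
          then obtain L where L: "M = L + 2 ^ i" by (metis add.commute le_Suc_ex not_less)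
          with M have "L < 2 ^ i" by simp
          then show ?thesis unfolding L by (rule a4')
        qed (rule a4')
        with t show "1 + cost (Arr 1 (Reg 11 \<ominus> Reg 15)) + (t + (1 + cost (Reg 16 \<oplus> Reg 16))) \<le> 50 * 2 ^ i + 20 \<and>
            reg (s''\<lparr>reg := (reg s'')(16 := val sel s'' (Reg 16 \<oplus> Reg 16))\<rparr>) 15 = i \<and>
            I (Suc i) ((s''\<lparr>reg := (reg s'')(16 := val sel s'' (Reg 16 \<oplus> Reg 16))\<rparr>)
              \<lparr>reg := (reg (s''\<lparr>reg := (reg s'')(16 := val sel s'' (Reg 16 \<oplus> Reg 16))\<rparr>))(15 := Suc i)\<rparr>)"
          by (simp add: r r' h' a' I_def same_upto_def)
      qed
    qed
  qed
  \<comment> \<open>The doublings form a geometric sum below \<open>50 * 2 ^ k\<close>; the overhead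
    of 30 per level is absorbed by \<open>k < 2 ^ k\<close>.\<close>
  have "(\<Sum>i<k. 50 * 2 ^ i + 20) + k * 10 + 28 \<le> 50 * 2 ^ k + 30 * k + 28" for k :: nat
    by (induction k) auto
  then have sum: "(\<Sum>i<k. 50 * 2 ^ i + 20) + k * 10 + 28 \<le> 80 * 2 ^ k + (28 :: nat)" for k :: nat
    by (rule order_trans) (use less_exp[of k] in linarith)
  show ?thesis
    unfolding clause_table_def
  proof (intro runs_Seq runs_Assign runs_Write, rule runs_mono[OF loop])
    show "I 0 ((s\<lparr>arr := (arr s)(4 := (arr s 4)(val sel s (Const 0) := val sel s (Const 1 \<ominus> Empty (Reg 14 \<oplus> Reg 2))))\<rparr>)
      \<lparr>reg := (reg (s\<lparr>arr := (arr s)(4 := (arr s 4)(val sel s (Const 0) := val sel s (Const 1 \<ominus> Empty (Reg 14 \<oplus> Reg 2))))\<rparr>))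
         (16 := val sel (s\<lparr>arr := (arr s)(4 := (arr s 4)(val sel s (Const 0) := val sel s (Const 1 \<ominus> Empty (Reg 14 \<oplus> Reg 2))))\<rparr>) (Const 1))\<rparr>
      \<lparr>reg := (reg ((s\<lparr>arr := (arr s)(4 := (arr s 4)(val sel s (Const 0) := val sel s (Const 1 \<ominus> Empty (Reg 14 \<oplus> Reg 2))))\<rparr>)
      \<lparr>reg := (reg (s\<lparr>arr := (arr s)(4 := (arr s 4)(val sel s (Const 0) := val sel s (Const 1 \<ominus> Empty (Reg 14 \<oplus> Reg 2))))\<rparr>))
         (16 := val sel (s\<lparr>arr := (arr s)(4 := (arr s 4)(val sel s (Const 0) := val sel s (Const 1 \<ominus> Empty (Reg 14 \<oplus> Reg 2))))\<rparr>) (Const 1))\<rparr>))(15 := 0)\<rparr>)"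
      using s by (simp add: I_def table_def same_upto_def)
  qed (use sum[of "bw + 1"] in \<open>auto simp: I_def\<close>)
qed

end

lemma runs_add_table:
  assumes "reg s 9 = N"
  shows "runs sel add_table s (\<lambda>t s'. t \<le> 20 * N + 10 \<and> same_upto 18 s s' \<and> hset s' = hset s \<and>
    (\<forall>a. a \<noteq> 3 \<longrightarrow> arr s' a = arr s a) \<and> (\<forall>x<N. arr s' 3 x = (arr s 3 x + arr s 4 x) mod 2))"
proof -
  define I where "I i s' \<longleftrightarrow> reg s' 18 = i \<and> same_upto 18 s s' \<and> hset s' = hset s \<and>
    (\<forall>a. a \<noteq> 3 \<longrightarrow> arr s' a = arr s a) \<and>
    arr s' 3 = (\<lambda>x. if x < i then (arr s 3 x + arr s 4 x) mod 2 else arr s 3 x)" for i s'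
  have "runs sel add_table s (\<lambda>t s'. t \<le> (\<Sum>i<N. 10) + N * (7 + cost (Reg 9)) + 5 + cost (Reg 9) \<and> I N s')"
    unfolding add_table_def
  proof (rule runs_For)
    fix i s' assume i: "i < N" and "I i s'"
    then show "runs sel (Write 3 (Reg 18) (Bin Add2 (Arr 3 (Reg 18)) (Arr 4 (Reg 18)))) s'
       (\<lambda>t s'. t \<le> 10 \<and> reg s' 18 = i \<and> I (Suc i) (s'\<lparr>reg := (reg s')(18 := Suc i)\<rparr>))"
      by (intro runs_intros) (auto simp: I_def same_upto_def fun_eq_iff less_Suc_eq)
  qed (use assms in \<open>simp_all add: I_def same_upto_def\<close>)
  then show ?thesis
    by (rule runs_mono) (auto simp: I_def)
qed

lemma runs_flush:
  assumes "reg s 9 = N" "reg s 12 = b"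
  shows "runs sel flush s (\<lambda>t s'. t \<le> 30 * N + 10 \<and> same_upto 18 s s' \<and> hset s' = hset s \<and>
    (\<forall>a. a \<noteq> 2 \<and> a \<noteq> 3 \<longrightarrow> arr s' a = arr s a) \<and> (\<forall>x<N. arr s' 3 x = 0) \<and>
    (\<forall>x<N. arr s' 2 (b + x) = (if arr s 3 x = 0 then arr s 2 (b + x) else 1)))"
proof -
  define I where "I i s' \<longleftrightarrow> reg s' 18 = i \<and> same_upto 18 s s' \<and> hset s' = hset s \<and>
    (\<forall>a. a \<noteq> 2 \<and> a \<noteq> 3 \<longrightarrow> arr s' a = arr s a) \<and>
    (\<forall>x. arr s' 3 x = (if x < i then 0 else arr s 3 x)) \<and>
    (\<forall>x. arr s' 2 (b + x) = (if x < i \<and> arr s 3 x \<noteq> 0 then 1 else arr s 2 (b + x)))" for i s'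
  let ?body = "If (Arr 3 (Reg 18)) (Write 2 (Reg 12 \<oplus> Reg 18) (Const 1) ;; Write 3 (Reg 18) (Const 0)) Skip"
  have "runs sel flush s (\<lambda>t s'. t \<le> (\<Sum>i<N. 15) + N * (7 + cost (Reg 9)) + 5 + cost (Reg 9) \<and> I N s')"
    unfolding flush_def
  proof (rule runs_For)
    fix i s' assume i: "i < N" and "I i s'"
    then show "runs sel ?body s'
       (\<lambda>t s'. t \<le> 15 \<and> reg s' 18 = i \<and> I (Suc i) (s'\<lparr>reg := (reg s')(18 := Suc i)\<rparr>))"
      using assms by (intro runs_intros) (auto simp: I_def same_upto_def less_Suc_eq)
  qed (use assms in \<open>simp_all add: I_def same_upto_def\<close>)
  then show ?thesis
    by (rule runs_mono) (auto simp: I_def)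
qed

lemma runs_shift:
  assumes "reg s 9 = N" "reg s 12 = b" "reg s 10 = k" "N = 2 * k"
  shows "runs sel shift s (\<lambda>t s'. t \<le> 40 * N + 15 \<and> (\<forall>x<18. x \<noteq> 12 \<longrightarrow> reg s' x = reg s x) \<and>
    hset s' = hset s \<and> (\<forall>a. a \<noteq> 2 \<longrightarrow> arr s' a = arr s a) \<and>
    (\<forall>x<N. arr s' 2 (reg s' 12 + x) = arr s 2 (b + x div 2) * arr s 2 (b + (x div 2 + k)) mod 2))"
proof -
  define I where "I i s' \<longleftrightarrow> reg s' 18 = i \<and> same_upto 18 s s' \<and> hset s' = hset s \<and>
    (\<forall>a. a \<noteq> 2 \<longrightarrow> arr s' a = arr s a) \<and> (\<forall>x<b + N. arr s' 2 x = arr s 2 x) \<and>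
    (\<forall>x<i. arr s' 2 (b + N + x) = arr s 2 (b + x div 2) * arr s 2 (b + (x div 2 + k)) mod 2)" for i s'
  let ?body = "Write 2 (Reg 12 \<oplus> Reg 9 \<oplus> Reg 18)
       (Bin Mul2 (Arr 2 (Reg 12 \<oplus> Half (Reg 18))) (Arr 2 (Reg 12 \<oplus> Half (Reg 18) \<oplus> Reg 10)))"
  have "runs sel (For 18 (Reg 9) ?body) s (\<lambda>t s'. t \<le> (\<Sum>i<N. 25) + N * (7 + cost (Reg 9)) + 5 + cost (Reg 9) \<and> I N s')"
  proof (rule runs_For)
    fix i s' assume i: "i < N" and I: "I i s'"
    \<comment> \<open>Both reads stay inside the old block, and writes begin behind it at
      \<open>b + N\<close>, so no flag is lost before it is read.\<close>
    then have "i div 2 < k" using assms(4) by simp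
    then have "i div 2 < N" "i div 2 + k < N" using assms(4) by simp_all
    with I assms(1-3)
    show "runs sel ?body s'
       (\<lambda>t s'. t \<le> 25 \<and> reg s' 18 = i \<and> I (Suc i) (s'\<lparr>reg := (reg s')(18 := Suc i)\<rparr>))"
      by (intro runs_intros) (auto simp: I_def same_upto_def less_Suc_eq add.assoc)
  qed (use assms in \<open>simp_all add: I_def same_upto_def\<close>)
  then show ?thesis
    unfolding shift_def
    by (intro runs_Seq, elim runs_mono, intro runs_Assign) (use assms in \<open>auto simp: I_def same_upto_def\<close>)
qed

context clause_system
begin

lemma runs_poly_constraint:
  assumes sel: "picker sel" and j: "j \<in> {1..m}" "hi j = e"
    and s: "reg s 2 = u" "reg s 8 = bw" "reg s 9 = W" "reg s 11 = e" "reg s 12 = b" "reg s 13 = j"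
    and inv: "\<forall>p\<le>n. arr s 1 p = var_at p"
    and h: "hset s (j + u) = H j" "\<forall>c\<in>H j. hset s (c + u) = H c"
    and zero: "\<forall>M<W. arr s 3 M = 0"
    and bad: "\<forall>M<W. arr s 2 (b + M) = of_bool (P M)"
  shows "runs sel poly_constraint s (\<lambda>t s'. t \<le> 300 * W * (1 + card (H j)) \<and> same_upto 14 s s' \<and>
    hset s' = (hset s)(j + u := {}) \<and> (\<forall>M<W. arr s' 3 M = 0) \<and> arr s' 1 = arr s 1 \<and>
    (\<forall>M<W. arr s' 2 (b + M) = of_bool (P M \<or> violated e j M)))"
proof -
  have fin: "finite (H j)" by (rule finite_clauses[OF j(1)])
  have e: "e \<le> n" using hi_le[OF j(1)] j(2) by simp
  \<comment> \<open>Clause handles exceed \<open>m\<close>, so draining handle \<open>j + u\<close>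
    leaves the contents of the clauses alone.\<close>
  have clash: "c + u \<noteq> j + u" if "c \<in> H j" for c
    using clauses[OF j(1)] that j(1) by fastforce
  \<comment> \<open>Array 3 holds the sum over the clauses already drained, that is, the parity of
    those with value 1.\<close>
  define I where "I F s' \<longleftrightarrow> same_upto 14 s s' \<and> hset s' = (hset s)(j + u := F) \<and>
    (\<forall>a. a \<noteq> 3 \<and> a \<noteq> 4 \<longrightarrow> arr s' a = arr s a) \<and>
    (\<forall>M<W. arr s' 3 M = of_bool (odd (card {c \<in> H j - F. table e c (bw + 1) M})))" for F s'
  have loop: "runs sel (Drain (Reg 13 \<oplus> Reg 2) 14 (clause_table ;; add_table)) s
    (\<lambda>t s'. t \<le> (\<Sum>c\<in>H j. 225 * W) + card (H j) * (8 + 3 * cost (Reg 13 \<oplus> Reg 2)) + 4 +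
      cost (Reg 13 \<oplus> Reg 2) \<and> I {} s')"
  proof (rule runs_Drain[OF sel fin])
    show "I (H j) s" using h zero by (simp add: I_def same_upto_def fun_upd_idem)
  next
    fix F s' assume "I F s'"
    then show "hset s' (val sel s' (Reg 13 \<oplus> Reg 2)) = F"
      using s by (simp add: I_def same_upto_def)
  next
    fix F s' c assume F: "F \<subseteq> H j" and c: "c \<in> F" and I: "I F s'"
    let ?s1 = "s'\<lparr>reg := (reg s')(14 := c), hset := (hset s')(val sel s' (Reg 13 \<oplus> Reg 2) := F - {c})\<rparr>"
    have r: "reg s' x = reg s x" if "x < 14" for x using I that by (simp add: I_def same_upto_def)
    have a: "arr s' a = arr s a" if "a \<noteq> 3" "a \<noteq> 4" for a using I that by (simp add: I_def)
    have hs: "hset ?s1 = (hset s)(j + u := F - {c})" using I s by (simp add: r I_def)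
    have cH: "c \<in> H j" using F c by blast
    have table: "runs sel clause_table ?s1 (\<lambda>t s''. t \<le> 200 * W \<and> same_upto 15 ?s1 s'' \<and> hset s'' = hset ?s1 \<and>
      (\<forall>a. a \<noteq> 4 \<longrightarrow> arr s'' a = arr ?s1 a) \<and> (\<forall>M<W. arr s'' 4 M = of_bool (table e c (bw + 1) M)))"
    proof (rule runs_clause_table[OF _ _ e])
      show "hset ?s1 (reg ?s1 14 + reg ?s1 2) = H c"
        unfolding hs using s h cH clash[OF cH] by (simp add: r)
    qed (use s inv in \<open>simp_all add: r a\<close>)
    \<comment> \<open>Moving \<open>c\<close> to the drained clauses flips the parity exactly if
      \<open>c\<close> has value 1, which is the addition done by \<open>Add2\<close>.\<close>
    have parity: "(odd (card {c \<in> H j - F. Q c}) \<noteq> Q c) = odd (card {c' \<in> H j - (F - {c}). Q c'})" for Q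
    proof -
      have "{c' \<in> H j - (F - {c}). Q c'} = (if Q c then insert c {c \<in> H j - F. Q c} else {c \<in> H j - F. Q c})"
        using cH by auto
      then show ?thesis using fin c by simp
    qed
    show "runs sel (clause_table ;; add_table) ?s1 (\<lambda>t s'. t \<le> 225 * W \<and> I (F - {c}) s')"
    proof (intro runs_Seq, rule runs_mono[OF table], rule runs_mono[OF runs_add_table[OF refl]])
      fix t t' s2 s3
      assume 2: "t \<le> 200 * W \<and> same_upto 15 ?s1 s2 \<and> hset s2 = hset ?s1 \<and>
        (\<forall>a. a \<noteq> 4 \<longrightarrow> arr s2 a = arr ?s1 a) \<and> (\<forall>M<W. arr s2 4 M = of_bool (table e c (bw + 1) M))"
      then have r2: "reg s2 x = reg s x" if "x < 14" for x
        using that r by (simp add: same_upto_def)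
      assume 3: "t' \<le> 20 * reg s2 9 + 10 \<and> same_upto 18 s2 s3 \<and> hset s3 = hset s2 \<and>
        (\<forall>a. a \<noteq> 3 \<longrightarrow> arr s3 a = arr s2 a) \<and> (\<forall>x<reg s2 9. arr s3 3 x = (arr s2 3 x + arr s2 4 x) mod 2)"
      have "t' \<le> 20 * W + 10" using 3 r2[of 9] s(3) by simp
      moreover have "10 \<le> 5 * W" by simp
      ultimately have "t + t' \<le> 225 * W" using 2 by linarith
      moreover have "arr s3 3 M = of_bool (odd (card {c' \<in> H j - (F - {c}). table e c' (bw + 1) M}))" if M: "M < W" for M
      proof -
        have "arr s3 3 M = (arr s' 3 M + of_bool (table e c (bw + 1) M)) mod 2"
          using 2 3 M r2[of 9] s(3) by simp
        also have "\<dots> = of_bool (odd (card {c' \<in> H j - F. table e c' (bw + 1) M}) \<noteq> table e c (bw + 1) M)"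
          using I M by (simp only: I_def of_bool_add_mod)
        finally show ?thesis unfolding parity[of "\<lambda>c. table e c (bw + 1) M"] .
      qed
      moreover have "same_upto 14 s s3" using 3 r2 by (simp add: same_upto_def)
      moreover have "hset s3 = (hset s)(j + u := F - {c})" using 2 3 hs by simp
      moreover have "\<forall>a. a \<noteq> 3 \<and> a \<noteq> 4 \<longrightarrow> arr s3 a = arr s a" using 2 3 a by simp
      ultimately show "t + t' \<le> 225 * W \<and> I (F - {c}) s3" unfolding I_def by blast
    qed
  qed simp
  show ?thesis
    unfolding poly_constraint_def
  proof (intro runs_Seq, rule runs_mono[OF loop], rule runs_mono[OF runs_flush[OF refl refl]])
    fix t t' s2 s3
    assume 2: "t \<le> (\<Sum>c\<in>H j. 225 * W) + card (H j) * (8 + 3 * cost (Reg 13 \<oplus> Reg 2)) + 4 +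
      cost (Reg 13 \<oplus> Reg 2) \<and> I {} s2"
    assume 3: "t' \<le> 30 * reg s2 9 + 10 \<and> same_upto 18 s2 s3 \<and> hset s3 = hset s2 \<and>
      (\<forall>a. a \<noteq> 2 \<and> a \<noteq> 3 \<longrightarrow> arr s3 a = arr s2 a) \<and> (\<forall>x<reg s2 9. arr s3 3 x = 0) \<and>
      (\<forall>x<reg s2 9. arr s3 2 (reg s2 12 + x) = (if arr s2 3 x = 0 then arr s2 2 (reg s2 12 + x) else 1))"
    have r: "reg s2 9 = W" "reg s2 12 = b" using 2 s by (simp_all add: I_def same_upto_def)
    have v: "\<forall>M<W. arr s2 3 M = of_bool (violated e j M)"
      using 2 by (simp add: I_def violated_def)
    have a2: "arr s2 2 = arr s 2" "arr s2 1 = arr s 1" using 2 by (simp_all add: I_def)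
    have W: "2 \<le> W" by simp
    have "t \<le> card (H j) * (225 * W + 17) + 7" using 2 by (simp add: algebra_simps)
    also have "\<dots> \<le> card (H j) * (300 * W) + 7 * W"
      using W by (intro add_mono mult_le_mono2) linarith+
    finally have "t + t' \<le> card (H j) * (300 * W) + 300 * W" using 3 r W by linarith
    then have "t + t' \<le> 300 * W * (1 + card (H j))" by (simp add: algebra_simps)
    moreover have "\<forall>M<W. arr s3 2 (b + M) = of_bool (P M \<or> violated e j M)"
      using 3 v bad a2 r by simp
    moreover have "same_upto 14 s s3" "hset s3 = (hset s)(j + u := {})" "arr s3 1 = arr s 1" "\<forall>M<W. arr s3 3 M = 0"
      using 2 3 a2 r by (simp_all add: I_def same_upto_def)
    ultimately show "t + t' \<le> 300 * W * (1 + card (H j)) \<and> same_upto 14 s s3 \<and>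
      hset s3 = (hset s)(j + u := {}) \<and> (\<forall>M<W. arr s3 3 M = 0) \<and> arr s3 1 = arr s 1 \<and>
      (\<forall>M<W. arr s3 2 (b + M) = of_bool (P M \<or> violated e j M))" by blast
  qed
qed

end

lemma runs_answer:
  assumes "reg s 9 = N" "reg s 12 = b"
  shows "runs sel answer s (\<lambda>t s'. t \<le> 30 * N + 20 \<and> reg s' 0 = of_bool (\<exists>x<N. arr s 2 (b + x) = 0))"
proof -
  define I where "I i s' \<longleftrightarrow> reg s' 18 = i \<and> reg s' 9 = N \<and> reg s' 12 = b \<and> arr s' = arr s \<and>
    reg s' 0 = of_bool (\<exists>x<i. arr s 2 (b + x) = 0)" for i and s' :: store
  have "runs sel (For 18 (Reg 9) (If (Arr 2 (Reg 12 \<oplus> Reg 18)) Skip (Assign 0 (Const 1))))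
      (s\<lparr>reg := (reg s)(0 := 0)\<rparr>) (\<lambda>t s'. t \<le> (\<Sum>i<N. 15) + N * (7 + cost (Reg 9)) + 5 + cost (Reg 9) \<and> I N s')"
  proof (rule runs_For)
    fix i s' assume i: "i < N" and "I i s'"
    then show "runs sel (If (Arr 2 (Reg 12 \<oplus> Reg 18)) Skip (Assign 0 (Const 1))) s'
       (\<lambda>t s'. t \<le> 15 \<and> reg s' 18 = i \<and> I (Suc i) (s'\<lparr>reg := (reg s')(18 := Suc i)\<rparr>))"
      by (intro runs_intros) (auto simp: I_def less_Suc_eq)
  qed (use assms in \<open>simp_all add: I_def\<close>)
  then show ?thesis
    unfolding answer_def
    by (intro runs_Seq runs_Assign) (auto simp: I_def elim!: runs_mono)
qed

section \<open>The sweep over the positions\<close>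

context clause_system
begin

abbreviation bucket :: "nat \<Rightarrow> nat set" where
  "bucket e \<equiv> {j \<in> {1..m}. hi j = e}"

text \<open>The state before position \<open>e\<close> is treated. Polynomials of earlier buckets
  have been drained, hence \<open>e \<le> hi j\<close>; clauses are only searched during the sweep,
  so all of them persist.\<close>

definition ready :: "nat \<Rightarrow> store \<Rightarrow> bool" where
  "ready e s \<longleftrightarrow> reg s 0 = n \<and> reg s 2 = u \<and> reg s 8 = bw \<and> reg s 9 = W \<and> reg s 10 = 2 ^ bw \<and>
     (\<forall>p\<le>n. arr s 1 p = var_at p) \<and> (\<forall>M<W. arr s 3 M = 0) \<and>
     (\<forall>M<W. arr s 2 (reg s 12 + M) = of_bool (bad e M)) \<and>
     (\<forall>j\<in>{1..m}. e \<le> hi j \<longrightarrow> hset s (j + u) = H j) \<and>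
     (\<forall>j\<in>{1..m}. \<forall>c\<in>H j. hset s (c + u) = H c) \<and>
     (\<forall>e'\<ge>e. hset s (u + u + e') = bucket e')"

lemma runs_bucket:
  assumes sel: "picker sel" and e: "reg s 11 = e" and ready: "ready e s"
  shows "runs sel (shift ;; Drain (Reg 2 \<oplus> Reg 2 \<oplus> Reg 11) 13 poly_constraint) s
    (\<lambda>t s'. t \<le> 100 * W + (\<Sum>j\<in>bucket e. 350 * W * (1 + card (H j))) \<and> reg s' 11 = e \<and> ready (Suc e) s')"
proof -
  define P where "P M \<longleftrightarrow> bad e (M div 2) \<and> bad e (M div 2 + 2 ^ bw)" for M
  note R = ready[unfolded ready_def]
  have fin: "finite (bucket e)" by simp
  define I where "I E s' \<longleftrightarrow> reg s' 0 = n \<and> reg s' 2 = u \<and> reg s' 8 = bw \<and> reg s' 9 = W \<and> reg s' 10 = 2 ^ bw \<and>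
     reg s' 11 = e \<and> (\<forall>p\<le>n. arr s' 1 p = var_at p) \<and> (\<forall>M<W. arr s' 3 M = 0) \<and>
     (\<forall>M<W. arr s' 2 (reg s' 12 + M) = of_bool (P M \<or> (\<exists>j\<in>bucket e - E. violated e j M))) \<and>
     (\<forall>j\<in>{1..m}. e < hi j \<or> j \<in> E \<longrightarrow> hset s' (j + u) = H j) \<and>
     (\<forall>j\<in>{1..m}. \<forall>c\<in>H j. hset s' (c + u) = H c) \<and>
     (\<forall>e'>e. hset s' (u + u + e') = bucket e') \<and> hset s' (u + u + e) = E" for E and s' :: store
  have loop: "runs sel (Drain (Reg 2 \<oplus> Reg 2 \<oplus> Reg 11) 13 poly_constraint) s0
      (\<lambda>t s'. t \<le> (\<Sum>j\<in>bucket e. 300 * W * (1 + card (H j))) +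
        card (bucket e) * (8 + 3 * cost (Reg 2 \<oplus> Reg 2 \<oplus> Reg 11)) + 4 + cost (Reg 2 \<oplus> Reg 2 \<oplus> Reg 11) \<and> I {} s')"
    if "I (bucket e) s0" for s0
  proof (rule runs_Drain[where I = I, OF sel fin that])
    fix E s' assume "I E s'"
    then show "hset s' (val sel s' (Reg 2 \<oplus> Reg 2 \<oplus> Reg 11)) = E"
      by (simp add: I_def)
  next
    fix E s' j assume E: "E \<subseteq> bucket e" and jE: "j \<in> E" and I: "I E s'"
    note I' = I[unfolded I_def]
    from E jE have j: "j \<in> {1..m}" "hi j = e" by auto
    let ?s1 = "s'\<lparr>reg := (reg s')(13 := j), hset := (hset s')(val sel s' (Reg 2 \<oplus> Reg 2 \<oplus> Reg 11) := E - {j})\<rparr>"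
    have hs: "hset ?s1 = (hset s')(u + u + e := E - {j})" using I' by simp
    have below: "c < u" if "c \<in> H j'" "j' \<in> {1..m}" for c j'
      using clauses[OF that(2)] that(1) by auto
    have low: "j' < u" if "j' \<in> {1..m}" for j' using that m_less by simp
    have clash: "c \<noteq> j" if "c \<in> H j'" "j' \<in> {1..m}" for c j'
      using clauses[OF that(2)] that(1) j(1) by fastforce
    have "runs sel poly_constraint ?s1 (\<lambda>t s2. t \<le> 300 * W * (1 + card (H j)) \<and> same_upto 14 ?s1 s2 \<and>
      hset s2 = (hset ?s1)(j + u := {}) \<and> (\<forall>M<W. arr s2 3 M = 0) \<and> arr s2 1 = arr ?s1 1 \<and>
      (\<forall>M<W. arr s2 2 (reg s' 12 + M) = of_bool ((P M \<or> (\<exists>j\<in>bucket e - E. violated e j M)) \<or> violated e j M)))"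
    proof (rule runs_poly_constraint[OF sel j])
      show "hset ?s1 (j + u) = H j"
        unfolding hs using I' j jE low[OF j(1)] by simp
      show "\<forall>c\<in>H j. hset ?s1 (c + u) = H c"
      proof
        fix c assume c: "c \<in> H j"
        with below[OF c j(1)] I' j(1) show "hset ?s1 (c + u) = H c" unfolding hs by simp
      qed
    qed (use I' in simp_all)
    then show "runs sel poly_constraint ?s1 (\<lambda>t s'. t \<le> 300 * W * (1 + card (H j)) \<and> I (E - {j}) s')"
    proof (rule runs_mono)
      fix t s2 assume 2: "t \<le> 300 * W * (1 + card (H j)) \<and> same_upto 14 ?s1 s2 \<and>
        hset s2 = (hset ?s1)(j + u := {}) \<and> (\<forall>M<W. arr s2 3 M = 0) \<and> arr s2 1 = arr ?s1 1 \<and>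
        (\<forall>M<W. arr s2 2 (reg s' 12 + M) = of_bool ((P M \<or> (\<exists>j\<in>bucket e - E. violated e j M)) \<or> violated e j M))"
      then have h2: "hset s2 = (hset s')(u + u + e := E - {j}, j + u := {})" unfolding hs by blast
      have r: "reg s2 x = reg s' x" if "x < 13" for x using 2 that by (simp add: same_upto_def)
      have eq: "(\<exists>i\<in>bucket e - (E - {j}). violated e i M) \<longleftrightarrow>
          (\<exists>i\<in>bucket e - E. violated e i M) \<or> violated e j M" for M
        using j by blast
      have "I (E - {j}) s2"
        unfolding I_def
      proof (intro conjI)
        show "\<forall>M<W. arr s2 2 (reg s2 12 + M) = of_bool (P M \<or> (\<exists>i\<in>bucket e - (E - {j}). violated e i M))"
          unfolding eq using 2 r[of 12] by (simp add: disj_assoc)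
        show "\<forall>j'\<in>{1..m}. e < hi j' \<or> j' \<in> E - {j} \<longrightarrow> hset s2 (j' + u) = H j'"
        proof (intro ballI impI)
          fix j' assume j': "j' \<in> {1..m}" "e < hi j' \<or> j' \<in> E - {j}"
          then have "j' \<noteq> j" using j by auto
          with j' low[OF j'(1)] I' show "hset s2 (j' + u) = H j'" unfolding h2 by auto
        qed
        show "\<forall>j'\<in>{1..m}. \<forall>c\<in>H j'. hset s2 (c + u) = H c"
        proof (intro ballI)
          fix j' c assume c: "j' \<in> {1..m}" "c \<in> H j'"
          with clash[OF c(2,1)] below[OF c(2,1)] I' show "hset s2 (c + u) = H c" unfolding h2 by auto
        qed
        show "\<forall>e'>e. hset s2 (u + u + e') = bucket e'" "hset s2 (u + u + e) = E - {j}"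
          using I' low[OF j(1)] unfolding h2 by auto
      qed (use 2 I' r in simp_all)
      with 2 show "t \<le> 300 * W * (1 + card (H j)) \<and> I (E - {j}) s2" by blast
    qed
  qed simp
  have shift: "runs sel shift s (\<lambda>t s'. t \<le> 40 * W + 15 \<and> (\<forall>x<18. x \<noteq> 12 \<longrightarrow> reg s' x = reg s x) \<and>
    hset s' = hset s \<and> (\<forall>a. a \<noteq> 2 \<longrightarrow> arr s' a = arr s a) \<and>
    (\<forall>x<W. arr s' 2 (reg s' 12 + x) =
      arr s 2 (reg s 12 + x div 2) * arr s 2 (reg s 12 + (x div 2 + 2 ^ bw)) mod 2))"
    by (rule runs_shift) (use R in simp_all)
  show ?thesis
  proof (intro runs_Seq, rule runs_mono[OF shift], rule runs_mono[OF loop])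
    fix t :: nat and s1 :: store assume 1: "t \<le> 40 * W + 15 \<and> (\<forall>x<18. x \<noteq> 12 \<longrightarrow> reg s1 x = reg s x) \<and>
      hset s1 = hset s \<and> (\<forall>a. a \<noteq> 2 \<longrightarrow> arr s1 a = arr s a) \<and>
      (\<forall>x<W. arr s1 2 (reg s1 12 + x) =
        arr s 2 (reg s 12 + x div 2) * arr s 2 (reg s 12 + (x div 2 + 2 ^ bw)) mod 2)"
    have "arr s1 2 (reg s1 12 + M) = of_bool (P M)" if M: "M < W" for M
    proof -
      have lt: "M div 2 < W" "M div 2 + 2 ^ bw < W" using M by simp_all
      have "arr s 2 (reg s 12 + M div 2) = of_bool (bad e (M div 2))"
        "arr s 2 (reg s 12 + (M div 2 + 2 ^ bw)) = of_bool (bad e (M div 2 + 2 ^ bw))"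
        using R lt by blast+
      with 1 M show ?thesis by (simp add: P_def)
    qed
    with 1 e R show "I (bucket e) s1" by (simp add: I_def)
    fix t' s2 assume 2: "t' \<le> (\<Sum>j\<in>bucket e. 300 * W * (1 + card (H j))) +
        card (bucket e) * (8 + 3 * cost (Reg 2 \<oplus> Reg 2 \<oplus> Reg 11)) + 4 + cost (Reg 2 \<oplus> Reg 2 \<oplus> Reg 11) \<and> I {} s2"
    have "ready (Suc e) s2"
    proof -
      \<comment> \<open>With the bucket empty, the disjunction collected by the invariant is the
        recursion equation of \<open>bad\<close>.\<close>
      have "bad (Suc e) M \<longleftrightarrow> P M \<or> (\<exists>j\<in>bucket e - {}. violated e j M)" for M
        unfolding P_def by auto
      with 2 show ?thesis unfolding ready_def I_def by (simp del: bad.simps)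
    qed
    moreover have "t + t' \<le> 100 * W + (\<Sum>j\<in>bucket e. 350 * W * (1 + card (H j)))"
    proof -
      \<comment> \<open>The handle expression costs 5, so a round of the drain costs
        \<open>8 + 3 * 5 = 23\<close> extra, which fits into the gap between 300 and 350.\<close>
      have "(\<Sum>j\<in>bucket e. 300 * W * (1 + card (H j))) + card (bucket e) * (8 + 3 * cost (Reg 2 \<oplus> Reg 2 \<oplus> Reg 11))
        = (\<Sum>j\<in>bucket e. 300 * W * (1 + card (H j)) + 23)"
        by (simp add: sum.distrib)
      also have "\<dots> \<le> (\<Sum>j\<in>bucket e. 350 * W * (1 + card (H j)))"
      proof (rule sum_mono)
        fix j
        have "1 * 1 \<le> W * (1 + card (H j))" by (rule mult_le_mono) simp_all
        then show "300 * W * (1 + card (H j)) + 23 \<le> 350 * W * (1 + card (H j))"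
          unfolding mult.assoc by linarith
      qed
      finally have "t + t' \<le> 40 * W + 15 + ((\<Sum>j\<in>bucket e. 350 * W * (1 + card (H j))) + 9)"
        using 1 2 by simp
      moreover have "2 \<le> W" by simp
      ultimately show ?thesis by linarith
    qed
    moreover have "reg s2 11 = e" using 2 by (simp add: I_def)
    ultimately show "t + t' \<le> 100 * W + (\<Sum>j\<in>bucket e. 350 * W * (1 + card (H j))) \<and> reg s2 11 = e \<and> ready (Suc e) s2"
      by blast
  qed
qed

lemma runs_sweep:
  assumes sel: "picker sel" and ready: "ready 0 s"
  shows "runs sel sweep s (\<lambda>t s'. t \<le> 400 * W * (n + 1 + (\<Sum>j\<in>{1..m}. 1 + card (H j))) \<and> ready (n + 1) s')"
proof -
  let ?T = "\<lambda>e. 100 * W + (\<Sum>j\<in>bucket e. 350 * W * (1 + card (H j)))"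
  have upd: "ready e (s'\<lparr>reg := (reg s')(11 := x)\<rparr>) = ready e s'" for e s' x
    by (simp add: ready_def)
  have "runs sel sweep s (\<lambda>t s'. t \<le> (\<Sum>e<n + 1. ?T e) + (n + 1) * (7 + cost (Reg 0 \<oplus> Const 1)) + 5 +
      cost (Reg 0 \<oplus> Const 1) \<and> (reg s' 11 = n + 1 \<and> ready (n + 1) s'))"
    unfolding sweep_def
  proof (rule runs_For)
    show "reg (s\<lparr>reg := (reg s)(11 := 0)\<rparr>) 11 = 0 \<and> ready 0 (s\<lparr>reg := (reg s)(11 := 0)\<rparr>)"
      using ready by (simp add: upd)
  next
    fix i s' assume "reg s' 11 = i \<and> ready i s'"
    then show "reg s' 11 = i \<and> val sel s' (Reg 0 \<oplus> Const 1) = n + 1"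
      by (simp add: ready_def)
  next
    fix i s' assume "reg s' 11 = i \<and> ready i s'"
    then have "runs sel (shift ;; Drain (Reg 2 \<oplus> Reg 2 \<oplus> Reg 11) 13 poly_constraint) s'
      (\<lambda>t s'. t \<le> ?T i \<and> reg s' 11 = i \<and> ready (Suc i) s')"
      by (intro runs_bucket[OF sel]) simp_all
    then show "runs sel (shift ;; Drain (Reg 2 \<oplus> Reg 2 \<oplus> Reg 11) 13 poly_constraint) s'
      (\<lambda>t s'. t \<le> ?T i \<and> reg s' 11 = i \<and> (reg (s'\<lparr>reg := (reg s')(11 := Suc i)\<rparr>) 11 = Suc i \<and>
        ready (Suc i) (s'\<lparr>reg := (reg s')(11 := Suc i)\<rparr>)))"
      by (rule runs_mono) (simp add: upd)
  qed
  moreover have "(\<Sum>e<n + 1. ?T e) + (n + 1) * (7 + cost (Reg 0 \<oplus> Const 1)) + 5 + cost (Reg 0 \<oplus> Const 1)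
    \<le> 400 * W * (n + 1 + (\<Sum>j\<in>{1..m}. 1 + card (H j)))"
  proof -
    \<comment> \<open>The buckets partition the polynomials, so each is paid for at one position
      only and the number of positions does not multiply the cost of the equations.\<close>
    have "(\<Sum>e<n + 1. \<Sum>j\<in>bucket e. 350 * W * (1 + card (H j))) = (\<Sum>j\<in>{1..m}. 350 * W * (1 + card (H j)))"
      by (rule sum.group) (use hi_le in \<open>auto simp: less_Suc_eq_le\<close>)
    also have "\<dots> = 350 * W * (\<Sum>j\<in>{1..m}. 1 + card (H j))"
      by (simp only: sum_distrib_left)
    finally have "(\<Sum>e<n + 1. ?T e) = 100 * W * (n + 1) + 350 * W * (\<Sum>j\<in>{1..m}. 1 + card (H j))"
      unfolding sum.distrib[of _ _ "{..<n + 1}"] by simp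
    moreover have "(n + 1) * 10 + 8 \<le> 300 * W * (n + 1)"
    proof -
      have "(n + 1) * 10 + 8 \<le> 300 * 1 * (n + 1)" by simp
      also have "\<dots> \<le> 300 * W * (n + 1)" by (intro mult_le_mono1 mult_le_mono2) simp
      finally show ?thesis .
    qed
    moreover have "400 * W * (n + 1 + x) = 400 * W * (n + 1) + 400 * W * x" for x
      by (simp add: algebra_simps)
    moreover have "400 * W * (n + 1) = 100 * W * (n + 1) + 300 * W * (n + 1)" by simp
    moreover have "350 * W * x \<le> 400 * W * x" for x by simp
    ultimately show ?thesis by simp
  qed
  ultimately show ?thesis
    by (elim runs_mono) auto
qed

end

section \<open>Preprocessing: inverse order, bandwidth and buckets\<close>

definition invert :: com where
  "invert = Write 1 (Const 0) (Reg 0 \<oplus> Const 1) ;;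
     For 3 (Reg 0) (Write 1 (Arr 0 (Reg 3 \<oplus> Const 1)) (Reg 3 \<oplus> Const 1))"

text \<open>Registers 6 and 7 carry the extreme positions across all clauses of a polynomial and are
  not reset here. The test against 1 skips the constant, which has no position.\<close>

definition scan_clause :: com where
  "scan_clause = Drain (Reg 4) 5
     (Insert (Reg 4 \<oplus> Reg 2) (Reg 5) ;;
      If (Bin Less (Const 1) (Reg 5))
        (If (Bin Less (Reg 6) (Arr 0 (Half (Reg 5)))) (Assign 6 (Arr 0 (Half (Reg 5)))) Skip ;;
         If (Bin Less (Arr 0 (Half (Reg 5))) (Reg 7)) (Assign 7 (Arr 0 (Half (Reg 5)))) Skip)
        Skip)"

text \<open>The start values 0 and \<open>n + 1\<close> are the defaults of \<open>hi\<close> and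
  \<open>lo\<close>; as \<open>Minus\<close> truncates, a polynomial without literals leaves
  register 8 unchanged and goes to bucket 0.\<close>

definition scan_poly :: com where
  "scan_poly = Assign 6 (Const 0) ;; Assign 7 (Reg 0 \<oplus> Const 1) ;;
     Drain (Reg 3) 4 (Insert (Reg 3 \<oplus> Reg 2) (Reg 4) ;; scan_clause) ;;
     If (Bin Less (Reg 8) (Reg 6 \<ominus> Reg 7)) (Assign 8 (Reg 6 \<ominus> Reg 7)) Skip ;;
     Insert (Reg 2 \<oplus> Reg 2 \<oplus> Reg 6) (Reg 3)"

definition scan :: com where
  "scan = Drain (Const 0) 3 scan_poly"

text \<open>Powers of two come from doubling by addition; register 10 lags one step behind register
  9.\<close>

definition powers :: com where
  "powers = Assign 9 (Const 1) ;;
     For 3 (Reg 8 \<oplus> Const 1) (Assign 10 (Reg 9) ;; Assign 9 (Reg 9 \<oplus> Reg 9))"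

definition solve :: com where
  "solve = invert ;; scan ;; powers ;; sweep ;; answer"

lemma runs_powers:
  assumes "reg s 8 = b"
  shows "runs sel powers s (\<lambda>t s'. t \<le> 30 * 2 ^ (b + 1) + 20 \<and> hset s' = hset s \<and> arr s' = arr s \<and>
    (\<forall>x. x \<noteq> 3 \<and> x \<noteq> 9 \<and> x \<noteq> 10 \<longrightarrow> reg s' x = reg s x) \<and> reg s' 9 = 2 ^ (b + 1) \<and> reg s' 10 = 2 ^ b)"
proof -
  define I where "I i s' \<longleftrightarrow> reg s' 3 = i \<and> hset s' = hset s \<and> arr s' = arr s \<and>
    (\<forall>x. x \<noteq> 3 \<and> x \<noteq> 9 \<and> x \<noteq> 10 \<longrightarrow> reg s' x = reg s x) \<and> reg s' 9 = 2 ^ i \<and>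
    (i \<noteq> 0 \<longrightarrow> reg s' 10 = 2 ^ (i - 1))" for i and s' :: store
  have loop: "runs sel (For 3 (Reg 8 \<oplus> Const 1) (Assign 10 (Reg 9) ;; Assign 9 (Reg 9 \<oplus> Reg 9)))
      s0 (\<lambda>t s'. t \<le> (\<Sum>i<b + 1. 10) + (b + 1) * (7 + cost (Reg 8 \<oplus> Const 1)) + 5 +
        cost (Reg 8 \<oplus> Const 1) \<and> I (b + 1) s')" if "I 0 (s0\<lparr>reg := (reg s0)(3 := 0)\<rparr>)" for s0
  proof (rule runs_For)
    show "I 0 (s0\<lparr>reg := (reg s0)(3 := 0)\<rparr>)" by (fact that)
  next
    fix i s' assume "I i s'"
    then show "runs sel (Assign 10 (Reg 9) ;; Assign 9 (Reg 9 \<oplus> Reg 9)) s'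
       (\<lambda>t s'. t \<le> 10 \<and> reg s' 3 = i \<and> I (Suc i) (s'\<lparr>reg := (reg s')(3 := Suc i)\<rparr>))"
      by (intro runs_intros) (auto simp: I_def)
  qed (use assms in \<open>simp_all add: I_def\<close>)
  have b: "b + 1 \<le> 2 ^ (b + 1)" by (rule less_imp_le[OF less_exp])
  show ?thesis
    unfolding powers_def
    by (intro runs_Seq runs_Assign, rule runs_mono[OF loop]) (use b in \<open>auto simp: I_def\<close>)
qed

text \<open>The heap during the scan: \<open>E\<close> are the polynomials still to come,
  \<open>D h\<close> is the part of \<open>H h\<close> already moved to \<open>h + u\<close>, and
  \<open>b\<close> are the buckets. The ranges do not overlap, so each update of the heap is an
  update of one argument.\<close>

definition layout :: "nat \<Rightarrow> (nat \<Rightarrow> nat set) \<Rightarrow> nat set \<Rightarrow> (nat \<Rightarrow> nat set) \<Rightarrow> (nat \<Rightarrow> nat set) \<Rightarrow> nat \<Rightarrow> nat set" where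
  "layout u H E D b h = (if h = 0 then E else if h < u then H h - D h
     else if h < u + u then D (h - u) else b (h - (u + u)))"

lemma layout_simps:
  "0 < u \<Longrightarrow> layout u H E D b 0 = E"
  "0 < x \<Longrightarrow> x < u \<Longrightarrow> layout u H E D b x = H x - D x"
  "0 < x \<Longrightarrow> x < u \<Longrightarrow> layout u H E D b (x + u) = D x"
  "0 < u \<Longrightarrow> layout u H E D b (u + u + e) = b e"
  by (auto simp: layout_def)

lemma layout_move:
  assumes "0 < x" "x < u"
  shows "(layout u H E D b)(x := H x - A, x + u := A) = layout u H E (D(x := A)) b"
  using assms by (auto simp: layout_def fun_eq_iff)

lemma layout_set: "0 < u \<Longrightarrow> (layout u H E D b)(0 := A) = layout u H A D b"
  by (auto simp: layout_def fun_eq_iff)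

lemma layout_bucket: "0 < u \<Longrightarrow> (layout u H E D b)(u + u + e := A) = layout u H E D (b(e := A))"
  by (auto simp: layout_def fun_eq_iff)

text \<open>A running maximum may be continued from one clause to the next.\<close>

lemma Max_nest: "finite A \<Longrightarrow> finite B \<Longrightarrow> Max (insert (Max (insert a A)) B) = Max (insert a (A \<union> B))"
  for a :: "'a::linorder"
proof -
  assume fin: "finite A" "finite B"
  have "Max (insert (Max (insert a A)) B) = Max (insert a A \<union> B)"
    using fin by (cases "B = {}") (simp_all only: Max.insert Max.union finite.insertI insert_not_empty Un_empty_right Max.singleton not_False_eq_True)
  then show ?thesis by simp
qed

lemma Min_nest: "finite A \<Longrightarrow> finite B \<Longrightarrow> Min (insert (Min (insert a A)) B) = Min (insert a (A \<union> B))"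
  for a :: "'a::linorder"
proof -
  assume fin: "finite A" "finite B"
  have "Min (insert (Min (insert a A)) B) = Min (insert a A \<union> B)"
    using fin by (cases "B = {}") (simp_all only: Min.insert Min.union finite.insertI insert_not_empty Un_empty_right Min.singleton not_False_eq_True)
  then show ?thesis by simp
qed

context clause_system
begin

abbreviation ord_array :: "nat \<Rightarrow> nat" where
  "ord_array \<equiv> (\<lambda>i. if i \<in> {1..n} then ord i else 0)"

text \<open>Positions start at 1, so the entry at index 0 keeps the dummy variable
  \<open>n + 1\<close>, to which truncated positions lead. Injectivity of \<open>ord\<close>
  protects the entries already written.\<close>

lemma runs_invert:
  assumes "reg s 0 = n" "arr s 0 = ord_array"
  shows "runs sel invert s (\<lambda>t s'. t \<le> 30 * n + 20 \<and> hset s' = hset s \<and> (\<forall>x. x \<noteq> 3 \<longrightarrow> reg s' x = reg s x) \<and>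
    (\<forall>a. a \<noteq> 1 \<longrightarrow> arr s' a = arr s a) \<and> (\<forall>p\<le>n. arr s' 1 p = var_at p))"
proof -
  define I where "I i s' \<longleftrightarrow> reg s' 3 = i \<and> hset s' = hset s \<and> (\<forall>x. x \<noteq> 3 \<longrightarrow> reg s' x = reg s x) \<and>
    (\<forall>a. a \<noteq> 1 \<longrightarrow> arr s' a = arr s a) \<and> arr s' 1 0 = n + 1 \<and> (\<forall>v\<in>{1..i}. arr s' 1 (ord v) = v)"
    for i and s' :: store
  let ?s0 = "s\<lparr>arr := (arr s)(1 := (arr s 1)(val sel s (Const 0) := val sel s (Reg 0 \<oplus> Const 1)))\<rparr>"
  have loop: "runs sel (For 3 (Reg 0) (Write 1 (Arr 0 (Reg 3 \<oplus> Const 1)) (Reg 3 \<oplus> Const 1))) ?s0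
    (\<lambda>t s'. t \<le> (\<Sum>i<n. 15) + n * (7 + cost (Reg 0)) + 5 + cost (Reg 0) \<and> I n s')"
  proof (rule runs_For)
    fix i s' assume i: "i < n" and I: "I i s'"
    then have v: "Suc i \<in> {1..n}" by simp
    have inj: "ord (Suc i) \<noteq> ord w" if "w \<in> {1..i}" for w
      using inj_on_contraD[of ord "{1..n}" "Suc i" w] ord that i by (simp add: bij_betw_def)
    have "ord (Suc i) \<in> {1..n}" using bij_betw_apply[OF ord v] .
    then have pos: "ord (Suc i) \<noteq> 0" by simp
    have all: "(\<forall>w\<in>{1..Suc i}. Q w) \<longleftrightarrow> Q (Suc i) \<and> (\<forall>w\<in>{1..i}. Q w)" for Q
      by (simp add: atLeastAtMostSuc_conv)
    have idx: "arr s' 0 (Suc i) = ord (Suc i)" "reg s' 3 = i" using I assms(2) i by (simp_all add: I_def)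
    have step: "I (Suc i) s2"
      if s2: "reg s2 3 = Suc i" "hset s2 = hset s'" "\<forall>x. x \<noteq> 3 \<longrightarrow> reg s2 x = reg s' x"
        "arr s2 = (arr s')(1 := (arr s' 1)(ord (Suc i) := Suc i))" for s2 :: store
    proof -
      have "\<forall>v\<in>{1..i}. arr s2 1 (ord v) = v"
      proof
        fix v assume v: "v \<in> {1..i}"
        with I have "arr s' 1 (ord v) = v" unfolding I_def by blast
        then show "arr s2 1 (ord v) = v" using inj[OF v] by (simp add: s2(4))
      qed
      moreover have "arr s2 1 (ord (Suc i)) = Suc i" "arr s2 1 0 = n + 1"
        using I pos by (simp_all add: s2(4) I_def)
      ultimately show ?thesis
        unfolding I_def all using I s2 by (simp add: I_def)
    qed
    show "runs sel (Write 1 (Arr 0 (Reg 3 \<oplus> Const 1)) (Reg 3 \<oplus> Const 1)) s'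
       (\<lambda>t s'. t \<le> 15 \<and> reg s' 3 = i \<and> I (Suc i) (s'\<lparr>reg := (reg s')(3 := Suc i)\<rparr>))"
    proof (intro runs_Write conjI step)
    qed (simp_all add: idx)
  qed (use assms in \<open>simp_all add: I_def\<close>)
  show ?thesis
    unfolding invert_def
  proof (intro runs_Seq runs_Write, rule runs_mono[OF loop])
    fix t s' assume t: "t \<le> (\<Sum>i<n. 15) + n * (7 + cost (Reg 0)) + 5 + cost (Reg 0) \<and> I n s'"
    have "arr s' 1 p = var_at p" if p: "p \<le> n" for p
    proof (cases "p = 0")
      case False
      with p have p: "p \<in> {1..n}" by simp
      have "var_at p \<in> {1..n}"
        using p ord inv_into_into[of p ord "{1..n}"] by (simp add: var_at_def bij_betw_def)
      with t have "arr s' 1 (ord (var_at p)) = var_at p" unfolding I_def by blast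
      then show ?thesis by (simp add: ord_var_at[OF p])
    qed (use t in \<open>simp add: I_def var_at_def\<close>)
    with t show "1 + cost (Const 0) + cost (Reg 0 \<oplus> Const 1) + t \<le> 30 * n + 20 \<and> hset s' = hset s \<and>
      (\<forall>x. x \<noteq> 3 \<longrightarrow> reg s' x = reg s x) \<and> (\<forall>a. a \<noteq> 1 \<longrightarrow> arr s' a = arr s a) \<and> (\<forall>p\<le>n. arr s' 1 p = var_at p)"
      by (simp add: I_def)
  qed
qed

lemma runs_scan_clause:
  assumes sel: "picker sel" and j: "j \<in> {1..m}" and c: "c \<in> H j"
    and s: "reg s 2 = u" "reg s 4 = c" "arr s 0 = ord_array"
    and h: "hset s = layout u H E D b" "D c = {}"
  shows "runs sel scan_clause s (\<lambda>t s'. t \<le> 60 * card (H c) + 10 \<and> arr s' = arr s \<and>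
    (\<forall>x. x \<noteq> 5 \<and> x \<noteq> 6 \<and> x \<noteq> 7 \<longrightarrow> reg s' x = reg s x) \<and> hset s' = layout u H E (D(c := H c)) b \<and>
    reg s' 6 = Max (insert (reg s 6) (place ` (H c - {1}))) \<and>
    reg s' 7 = Min (insert (reg s 7) (place ` (H c - {1}))))"
proof -
  have fin: "finite (H c)" using codes[OF j c] by blast
  have c_pos: "0 < c" "c < u" using clauses[OF j] c by auto
  define I where "I G s' \<longleftrightarrow> arr s' = arr s \<and>
    (\<forall>x. x \<noteq> 5 \<and> x \<noteq> 6 \<and> x \<noteq> 7 \<longrightarrow> reg s' x = reg s x) \<and> hset s' = layout u H E (D(c := H c - G)) b \<and>
    reg s' 6 = Max (insert (reg s 6) (place ` (H c - G - {1}))) \<and>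
    reg s' 7 = Min (insert (reg s 7) (place ` (H c - G - {1})))" for G and s' :: store
  let ?body = "Insert (Reg 4 \<oplus> Reg 2) (Reg 5) ;;
      If (Bin Less (Const 1) (Reg 5))
        (If (Bin Less (Reg 6) (Arr 0 (Half (Reg 5)))) (Assign 6 (Arr 0 (Half (Reg 5)))) Skip ;;
         If (Bin Less (Arr 0 (Half (Reg 5))) (Reg 7)) (Assign 7 (Arr 0 (Half (Reg 5)))) Skip)
        Skip"
  have "runs sel scan_clause s (\<lambda>t s'. t \<le> (\<Sum>k\<in>H c. 45) + card (H c) * (8 + 3 * cost (Reg 4)) + 4 + cost (Reg 4) \<and> I {} s')"
    unfolding scan_clause_def
  proof (rule runs_Drain[where I = I, OF sel fin])
    show "I (H c) s" using h by (simp add: I_def fun_upd_idem)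
  next
    fix G s' assume "G \<subseteq> H c" "I G s'"
    then show "hset s' (val sel s' (Reg 4)) = G"
      using s c_pos by (auto simp: I_def layout_simps)
  next
    fix G s' k assume G: "G \<subseteq> H c" and k: "k \<in> G" and I: "I G s'"
    let ?s1 = "s'\<lparr>reg := (reg s')(5 := k), hset := (hset s')(val sel s' (Reg 4) := G - {k})\<rparr>"
    note I' = I[unfolded I_def]
    have kH: "k \<in> H c" using G k by blast
    have S: "H c - (G - {k}) = insert k (H c - G)"
      using kH by blast
    have P: "place ` (H c - (G - {k}) - {1}) =
        (if k = 1 then place ` (H c - G - {1}) else insert (place k) (place ` (H c - G - {1})))"
      unfolding S by auto
    have fin': "finite (place ` (H c - G - {1}))" using fin by simp
    \<comment> \<open>A code other than 1 has a variable from 1 on, so it is at least 2 and the test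
      of the program recognises exactly the literals.\<close>
    have place: "1 < k \<and> arr s 0 (k div 2) = place k" if "k \<noteq> 1"
    proof -
      have "k div 2 \<in> {1..n}" using codes[OF j c] kH that by blast
      then show ?thesis by (auto simp: s(3) place_def)
    qed
    have hs: "(hset s')(c := G - {k}, c + u := insert k (H c - G)) = layout u H E (D(c := H c - (G - {k}))) b"
    proof -
      have "G - {k} = H c - (H c - (G - {k}))" using G by blast
      moreover have "(layout u H E (D(c := H c - G)) b)(c := H c - (H c - (G - {k})), c + u := H c - (G - {k})) =
          layout u H E (D(c := H c - (G - {k}))) b"
        by (simp add: layout_move[OF c_pos])
      ultimately show ?thesis using I' S by simp
    qed
    have cu: "hset s' (c + u) = H c - G"
      using I' c_pos by (simp add: layout_simps)
    have M: "Max (insert (reg s 6) (insert p (place ` (H c - G - {1})))) = max p (reg s' 6)"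
      "Min (insert (reg s 7) (insert p (place ` (H c - G - {1})))) = min p (reg s' 7)" for p
      using I' fin' by (simp_all add: insert_commute[of _ p])
    have step: "I (G - {k}) s2"
      if "arr s2 = arr s'" "\<forall>x. x \<noteq> 5 \<and> x \<noteq> 6 \<and> x \<noteq> 7 \<longrightarrow> reg s2 x = reg s' x"
        "hset s2 = (hset s')(c := G - {k}, c + u := insert k (H c - G))"
        "reg s2 6 = (if k = 1 then reg s' 6 else max (place k) (reg s' 6))"
        "reg s2 7 = (if k = 1 then reg s' 7 else min (place k) (reg s' 7))" for s2 :: store
      unfolding I_def P hs[symmetric] using that I' M[of "place k"] by simp
    have r: "reg s' 2 = u" "reg s' 4 = c" using I' s by simp_all
    have a: "arr s' 0 (k div 2) = place k" "1 < k" if "k \<noteq> 1" using place[OF that] I' by simp_all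
    show "runs sel ?body ?s1 (\<lambda>t s'. t \<le> 45 \<and> I (G - {k}) s')"
    proof (cases "k = 1")
      case True
      then show ?thesis
        by (intro runs_intros conjI step) (use c_pos in \<open>simp_all add: r cu\<close>)
    next
      case False
      note a = a[OF False]
      from False show ?thesis
        by (intro runs_intros conjI step) (use a(2) c_pos in \<open>simp_all add: r cu a(1)\<close>)
    qed
  qed simp
  then show ?thesis
    by (rule runs_mono) (auto simp: I_def)
qed

lemma runs_scan_poly:
  assumes sel: "picker sel" and j: "j \<in> {1..m}"
    and s: "reg s 0 = n" "reg s 2 = u" "reg s 3 = j" "arr s 0 = ord_array"
    and h: "hset s = layout u H E D b" "D j = {}" "\<And>c. c \<in> H j \<Longrightarrow> D c = {}"
  shows "runs sel scan_poly s (\<lambda>t s'. t \<le> 60 * (1 + (\<Sum>c\<in>H j. 1 + card (H c))) \<and> arr s' = arr s \<and>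
    (\<forall>x. x \<noteq> 8 \<and> (x < 4 \<or> 7 < x) \<longrightarrow> reg s' x = reg s x) \<and> reg s' 8 = max (reg s 8) (hi j - lo j) \<and>
    hset s' = layout u H E (\<lambda>x. if x = j \<or> x \<in> H j then H x else D x) (b(hi j := insert j (b (hi j)))))"
proof -
  have fin: "finite (H j)" by (rule finite_clauses[OF j])
  have j_pos: "0 < j" "j < u" using j m_less by auto
  have jH: "c \<noteq> j" "0 < c" "c < u" if "c \<in> H j" for c using clauses[OF j] that j by fastforce+
  define Q where "Q F = place ` (\<Union>c\<in>H j - F. H c - {1})" for F
  have finQ: "finite (Q F)" for F
    unfolding Q_def by (rule finite_imageI[OF finite_subset[OF _ finite_lits[OF j]]]) (auto simp: lits_def)
  \<comment> \<open>Clauses in \<open>H j - F\<close> have been moved completely, and so has this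
    part of \<open>H j\<close>; everything else is as in \<open>D\<close>.\<close>
  define DF where "DF F x = (if x = j then H j - F else if x \<in> H j - F then H x else D x)" for F x
  define I where "I F s' \<longleftrightarrow> arr s' = arr s \<and> (\<forall>x. x < 4 \<or> 7 < x \<longrightarrow> reg s' x = reg s x) \<and>
    hset s' = layout u H E (DF F) b \<and> reg s' 6 = Max (insert 0 (Q F)) \<and> reg s' 7 = Min (insert (n + 1) (Q F))"
    for F and s' :: store
  have loop: "runs sel (Drain (Reg 3) 4 (Insert (Reg 3 \<oplus> Reg 2) (Reg 4) ;; scan_clause)) s0
      (\<lambda>t s'. t \<le> (\<Sum>c\<in>H j. 60 * card (H c) + 20) + card (H j) * (8 + 3 * cost (Reg 3)) + 4 + cost (Reg 3) \<and> I {} s')"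
    if "I (H j) s0" for s0
  proof (rule runs_Drain[where I = I, OF sel fin that])
    fix F s' assume "F \<subseteq> H j" "I F s'"
    then show "hset s' (val sel s' (Reg 3)) = F"
      using s j_pos by (auto simp: I_def layout_simps DF_def)
  next
    fix F s' c assume F: "F \<subseteq> H j" and c: "c \<in> F" and I: "I F s'"
    note I' = I[unfolded I_def]
    have cH: "c \<in> H j" using F c by blast
    let ?s1 = "s'\<lparr>reg := (reg s')(4 := c), hset := (hset s')(val sel s' (Reg 3) := F - {c})\<rparr>"
    let ?s2 = "?s1\<lparr>hset := (hset ?s1)(val sel ?s1 (Reg 3 \<oplus> Reg 2) :=
      insert (val sel ?s1 (Reg 4)) (hset ?s1 (val sel ?s1 (Reg 3 \<oplus> Reg 2))))\<rparr>"
    have r: "reg s' 3 = j" "reg s' 2 = u" using I' s by simp_all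
    have S: "H j - (F - {c}) = insert c (H j - F)" using cH by blast
    have h2: "hset ?s2 = layout u H E ((DF F)(j := H j - (F - {c}))) b"
    proof -
      have "hset s' (j + u) = H j - F"
        using I' j_pos by (simp add: layout_simps DF_def)
      then have "hset ?s2 = (hset s')(j := F - {c}, j + u := H j - (F - {c}))"
        using j_pos unfolding S by (simp add: r)
      moreover have "F - {c} = H j - (H j - (F - {c}))" using F by blast
      moreover have "(layout u H E (DF F) b)(j := H j - (H j - (F - {c})), j + u := H j - (F - {c})) =
          layout u H E ((DF F)(j := H j - (F - {c}))) b"
        by (rule layout_move[OF j_pos])
      ultimately show ?thesis using I' by simp
    qed
    have D_next: "((DF F)(j := H j - (F - {c})))(c := H c) = DF (F - {c})"
      using cH jH(1)[OF cH] by (auto simp: DF_def fun_eq_iff)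
    have Q_next: "Q F \<union> place ` (H c - {1}) = Q (F - {c})"
      unfolding Q_def S by auto
    have "runs sel scan_clause ?s2 (\<lambda>t s'. t \<le> 60 * card (H c) + 10 \<and> arr s' = arr ?s2 \<and>
      (\<forall>x. x \<noteq> 5 \<and> x \<noteq> 6 \<and> x \<noteq> 7 \<longrightarrow> reg s' x = reg ?s2 x) \<and>
      hset s' = layout u H E (((DF F)(j := H j - (F - {c})))(c := H c)) b \<and>
      reg s' 6 = Max (insert (reg ?s2 6) (place ` (H c - {1}))) \<and>
      reg s' 7 = Min (insert (reg ?s2 7) (place ` (H c - {1}))))"
    proof (rule runs_scan_clause[OF sel j cH _ _ _ h2])
      show "((DF F)(j := H j - (F - {c}))) c = {}"
        using jH(1)[OF cH] h(3)[OF cH] c by (simp add: DF_def)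
    qed (use I' s r in simp_all)
    moreover have "finite (place ` (H c - {1}))" using codes[OF j cH] by simp
    note nest = Max_nest[OF finQ this] Min_nest[OF finQ this]
    ultimately show "runs sel (Insert (Reg 3 \<oplus> Reg 2) (Reg 4) ;; scan_clause) ?s1
      (\<lambda>t s'. t \<le> 60 * card (H c) + 20 \<and> I (F - {c}) s')"
      unfolding D_next
      by (intro runs_Seq runs_Insert, elim runs_mono)
        (use I' in \<open>simp add: I_def nest[simplified] Q_next[simplified]\<close>)
  qed simp
  have hi_lo: "hi j = Max (insert 0 (Q {}))" "lo j = Min (insert (n + 1) (Q {}))"
    by (simp_all add: hi_def lo_def Q_def lits_def)
  have time: "(\<Sum>c\<in>H j. 60 * card (H c) + 20) + card (H j) * 11 + 40 \<le> 60 * (1 + (\<Sum>c\<in>H j. 1 + card (H c)))"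
  proof -
    have "(\<Sum>c\<in>H j. 60 * card (H c) + 20) + card (H j) * 11 = (\<Sum>c\<in>H j. 60 * card (H c) + 31)"
      by (simp add: sum.distrib)
    also have "\<dots> \<le> (\<Sum>c\<in>H j. 60 * (1 + card (H c)))" by (rule sum_mono) simp
    also have "\<dots> = 60 * (\<Sum>c\<in>H j. 1 + card (H c))" by (simp only: sum_distrib_left)
    finally show ?thesis by simp
  qed
  have D_all: "DF {} = (\<lambda>x. if x = j \<or> x \<in> H j then H x else D x)"
    by (auto simp: DF_def fun_eq_iff)
  have D_start: "DF (H j) = D"
    using h(2) by (auto simp: DF_def fun_eq_iff)
  have u: "0 < u" using j_pos by simp
  show ?thesis
    unfolding scan_poly_def
  proof (intro runs_Seq runs_Assign, rule runs_mono[OF loop])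
    let ?s1 = "s\<lparr>reg := (reg s)(6 := val sel s (Const 0))\<rparr>"
    show "I (H j) (?s1\<lparr>reg := (reg ?s1)(7 := val sel ?s1 (Reg 0 \<oplus> Const 1))\<rparr>)"
      using s h by (simp add: I_def D_start Q_def)
    fix t s' assume *: "t \<le> (\<Sum>c\<in>H j. 60 * card (H c) + 20) + card (H j) * (8 + 3 * cost (Reg 3)) + 4 + cost (Reg 3) \<and> I {} s'"
    then have I: "arr s' = arr s" "\<And>x. x < 4 \<or> 7 < x \<Longrightarrow> reg s' x = reg s x"
      "hset s' = layout u H E (\<lambda>x. if x = j \<or> x \<in> H j then H x else D x) b" "reg s' 6 = hi j" "reg s' 7 = lo j"
      by (simp_all only: I_def hi_lo D_all)
    have t: "t + 35 \<le> 60 * (1 + (\<Sum>c\<in>H j. 1 + card (H c)))"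
      using * time by simp
    show "runs sel (If (Bin Less (Reg 8) (Reg 6 \<ominus> Reg 7)) (Assign 8 (Reg 6 \<ominus> Reg 7)) Skip ;;
       Insert (Reg 2 \<oplus> Reg 2 \<oplus> Reg 6) (Reg 3)) s'
      (\<lambda>t' s'. 1 + cost (Const 0) + (1 + cost (Reg 0 \<oplus> Const 1) + (t + t')) \<le> 60 * (1 + (\<Sum>c\<in>H j. 1 + card (H c))) \<and>
        arr s' = arr s \<and> (\<forall>x. x \<noteq> 8 \<and> (x < 4 \<or> 7 < x) \<longrightarrow> reg s' x = reg s x) \<and>
        reg s' 8 = max (reg s 8) (hi j - lo j) \<and>
        hset s' = layout u H E (\<lambda>x. if x = j \<or> x \<in> H j then H x else D x) (b(hi j := insert j (b (hi j)))))"
      using t by (intro runs_intros conjI) (simp_all add: I s layout_simps(4)[OF u] layout_bucket[OF u])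
  qed
qed

definition clauses_of :: "nat set \<Rightarrow> nat set" where
  "clauses_of J = (\<Union>j\<in>J. H j)"

lemma runs_scan:
  assumes sel: "picker sel"
    and s: "reg s 0 = n" "reg s 2 = u" "reg s 8 = 0" "arr s 0 = ord_array"
    and h: "hset s = layout u H {1..m} (\<lambda>_. {}) (\<lambda>_. {})"
  shows "runs sel scan s (\<lambda>t s'. t \<le> 80 * (1 + (\<Sum>j\<in>{1..m}. 1 + (\<Sum>c\<in>H j. 1 + card (H c)))) \<and> arr s' = arr s \<and>
    (\<forall>x. x < 3 \<or> 8 < x \<longrightarrow> reg s' x = reg s x) \<and> reg s' 8 = bw \<and>
    (\<forall>j\<in>{1..m}. hset s' (j + u) = H j) \<and> (\<forall>j\<in>{1..m}. \<forall>c\<in>H j. hset s' (c + u) = H c) \<and>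
    (\<forall>e. hset s' (u + u + e) = bucket e))"
proof -
  define DE where "DE E x = (if x \<in> {1..m} - E \<or> x \<in> clauses_of ({1..m} - E) then H x else {})" for E x
  define I where "I E s' \<longleftrightarrow> arr s' = arr s \<and> (\<forall>x. x < 3 \<or> 8 < x \<longrightarrow> reg s' x = reg s x) \<and>
    reg s' 8 = Max (insert 0 ((\<lambda>j. hi j - lo j) ` ({1..m} - E))) \<and>
    hset s' = layout u H E (DE E) (\<lambda>e. {j \<in> {1..m} - E. hi j = e})" for E and s' :: store
  have u: "0 < u" using m_less by simp
  have "runs sel scan s (\<lambda>t s'. t \<le> (\<Sum>j\<in>{1..m}. 60 * (1 + (\<Sum>c\<in>H j. 1 + card (H c)))) +
      card {1..m} * (8 + 3 * cost (Const 0)) + 4 + cost (Const 0) \<and> I {} s')"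
    unfolding scan_def
  proof (rule runs_Drain[where I = I, OF sel])
    have "DE {1..m} = (\<lambda>_. {})" by (simp add: DE_def clauses_of_def fun_eq_iff)
    then show "I {1..m} s" using s h by (simp add: I_def)
  next
    fix E s' assume "I E s'"
    then show "hset s' (val sel s' (Const 0)) = E" by (simp add: I_def layout_simps(1)[OF u])
  next
    fix E s' j assume E: "E \<subseteq> {1..m}" and jE: "j \<in> E" and I: "I E s'"
    note I' = I[unfolded I_def]
    have j: "j \<in> {1..m}" using E jE by blast
    have high: "m < c" if "c \<in> H i" "i \<in> {1..m}" for c i using clauses[OF that(2)] that(1) by auto
    let ?s1 = "s'\<lparr>reg := (reg s')(3 := j), hset := (hset s')(val sel s' (Const 0) := E - {j})\<rparr>"
    have h1: "hset ?s1 = layout u H (E - {j}) (DE E) (\<lambda>e. {i \<in> {1..m} - E. hi i = e})"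
      using I' by (simp add: layout_set[OF u])
    have S: "{1..m} - (E - {j}) = insert j ({1..m} - E)" using j by blast
    have D_next: "(\<lambda>x. if x = j \<or> x \<in> H j then H x else DE E x) = DE (E - {j})"
      unfolding DE_def S by (auto simp: clauses_of_def fun_eq_iff)
    have b_next: "(\<lambda>e. {i \<in> {1..m} - E. hi i = e})(hi j := insert j {i \<in> {1..m} - E. hi i = hi j}) =
        (\<lambda>e. {i \<in> {1..m} - (E - {j}). hi i = e})"
      unfolding S by (auto simp: fun_eq_iff)
    have M: "Max (insert 0 ((\<lambda>j. hi j - lo j) ` ({1..m} - (E - {j})))) =
        max (Max (insert 0 ((\<lambda>j. hi j - lo j) ` ({1..m} - E)))) (hi j - lo j)"
      unfolding S image_insert insert_commute[of 0] by (simp add: max.commute)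
    have "runs sel scan_poly ?s1 (\<lambda>t s''. t \<le> 60 * (1 + (\<Sum>c\<in>H j. 1 + card (H c))) \<and> arr s'' = arr ?s1 \<and>
      (\<forall>x. x \<noteq> 8 \<and> (x < 4 \<or> 7 < x) \<longrightarrow> reg s'' x = reg ?s1 x) \<and> reg s'' 8 = max (reg ?s1 8) (hi j - lo j) \<and>
      hset s'' = layout u H (E - {j}) (\<lambda>x. if x = j \<or> x \<in> H j then H x else DE E x)
        ((\<lambda>e. {i \<in> {1..m} - E. hi i = e})(hi j := insert j {i \<in> {1..m} - E. hi i = hi j})))"
    proof (rule runs_scan_poly[OF sel j _ _ _ _ h1])
      show "DE E j = {}"
      proof -
        have "j \<notin> H i" if "i \<in> {1..m}" for i
          using high[of j i] that j by auto
        with jE show ?thesis by (auto simp: DE_def clauses_of_def)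
      qed
      \<comment> \<open>\<open>c\<close> is still in place: it exceeds \<open>m\<close>, and by
        disjointness no polynomial scanned earlier has moved it.\<close>
      show "DE E c = {}" if c: "c \<in> H j" for c
      proof -
        have "c \<notin> H i" if "i \<in> {1..m} - E" for i
          using disjoint_family_onD[OF disjoint, of j i] that j jE c by blast
        moreover have "c \<notin> {1..m}" using high[OF c j] by simp
        ultimately show ?thesis by (auto simp: DE_def clauses_of_def)
      qed
    qed (use I' s in simp_all)
    then show "runs sel scan_poly ?s1 (\<lambda>t s'. t \<le> 60 * (1 + (\<Sum>c\<in>H j. 1 + card (H c))) \<and> I (E - {j}) s')"
      unfolding D_next b_next
      by (rule runs_mono) (use I' M in \<open>simp add: I_def\<close>)
  qed simp_all
  moreover have "(\<Sum>j\<in>{1..m}. 60 * (1 + (\<Sum>c\<in>H j. 1 + card (H c)))) + card {1..m} * (8 + 3 * cost (Const 0)) + 4 + cost (Const 0)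
    \<le> 80 * (1 + (\<Sum>j\<in>{1..m}. 1 + (\<Sum>c\<in>H j. 1 + card (H c))))"
  proof -
    have "(\<Sum>j\<in>{1..m}. 60 * (1 + (\<Sum>c\<in>H j. 1 + card (H c)))) + card {1..m} * 11 =
        (\<Sum>j\<in>{1..m}. 60 * (1 + (\<Sum>c\<in>H j. 1 + card (H c))) + 11)"
      by (simp only: sum.distrib sum_constant of_nat_id)
    also have "\<dots> \<le> (\<Sum>j\<in>{1..m}. 80 * (1 + (\<Sum>c\<in>H j. 1 + card (H c))))"
    proof (rule sum_mono)
      have "60 * (1 + x) + 11 \<le> 80 * (1 + x)" for x :: nat by simp
      then show "60 * (1 + (\<Sum>c\<in>H j. 1 + card (H c))) + 11 \<le> 80 * (1 + (\<Sum>c\<in>H j. 1 + card (H c)))" for j .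
    qed
    also have "\<dots> = 80 * (\<Sum>j\<in>{1..m}. 1 + (\<Sum>c\<in>H j. 1 + card (H c)))"
      by (simp only: sum_distrib_left)
    finally show ?thesis by simp
  qed
  ultimately show ?thesis
  proof (elim runs_mono)
    fix t s' assume le: "(\<Sum>j\<in>{1..m}. 60 * (1 + (\<Sum>c\<in>H j. 1 + card (H c)))) + card {1..m} * (8 + 3 * cost (Const 0)) + 4 + cost (Const 0)
      \<le> 80 * (1 + (\<Sum>j\<in>{1..m}. 1 + (\<Sum>c\<in>H j. 1 + card (H c))))"
      and *: "t \<le> (\<Sum>j\<in>{1..m}. 60 * (1 + (\<Sum>c\<in>H j. 1 + card (H c)))) +
        card {1..m} * (8 + 3 * cost (Const 0)) + 4 + cost (Const 0) \<and> I {} s'"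
    have pos: "0 < x \<and> x < u" if "x \<in> {1..m} \<or> (\<exists>j\<in>{1..m}. x \<in> H j)" for x
    proof -
      have "0 < x \<and> x < u" if "x \<in> H j" "j \<in> {1..m}" for j
        using clauses[OF that(2)] that(1) by auto
      then show ?thesis using that m_less by auto
    qed
    have "hset s' (x + u) = H x" if "x \<in> {1..m} \<or> (\<exists>j\<in>{1..m}. x \<in> H j)" for x
      using * pos[OF that] that by (auto simp: I_def layout_simps DE_def clauses_of_def)
    moreover have "hset s' (u + u + e) = bucket e" for e
      using * by (simp add: I_def layout_simps(4)[OF u])
    moreover have "reg s' 8 = bw" using * by (simp add: I_def bw_def)
    ultimately show "t \<le> 80 * (1 + (\<Sum>j\<in>{1..m}. 1 + (\<Sum>c\<in>H j. 1 + card (H c)))) \<and> arr s' = arr s \<and>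
      (\<forall>x. x < 3 \<or> 8 < x \<longrightarrow> reg s' x = reg s x) \<and> reg s' 8 = bw \<and>
      (\<forall>j\<in>{1..m}. hset s' (j + u) = H j) \<and> (\<forall>j\<in>{1..m}. \<forall>c\<in>H j. hset s' (c + u) = H c) \<and>
      (\<forall>e. hset s' (u + u + e) = bucket e)"
      using order_trans[OF conjunct1[OF *] le] * unfolding I_def by blast
  qed
qed

end

section \<open>Total running time of the program\<close>

context clause_system
begin

text \<open>A code other than 1 is determined by its position between \<open>lo j\<close> and
  \<open>hi j\<close> and its parity, which leaves \<open>2 * (bw + 1)\<close> choices, and
  \<open>bw + 1 \<le> W\<close>.\<close>

lemma card_clause_le:
  assumes j: "j \<in> {1..m}" and c: "c \<in> H j"
  shows "card (H c) \<le> 3 * W"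
proof -
  let ?P = "{lo j..hi j} \<times> {0, 1 :: nat}"
  have "k \<in> insert 1 ((\<lambda>(p, b). 2 * var_at p + b) ` ?P)" if k: "k \<in> H c" for k
  proof (cases "k = 1")
    case False
    with k c have lit: "k \<in> lits j" by (auto simp: lits_def)
    have "var_at (place k) = k div 2"
      unfolding place_def by (rule var_at_ord[OF lits_var[OF j lit]])
    then have "k = 2 * var_at (place k) + k mod 2" by simp
    moreover have "(place k, k mod 2) \<in> ?P"
      using place_le_hi[OF j lit] lo_le_place[OF j lit] by auto
    ultimately have "k \<in> (\<lambda>(p, b). 2 * var_at p + b) ` ?P"
      by (intro image_eqI[of _ _ "(place k, k mod 2)"]) simp_all
    then show ?thesis by (rule insertI2)
  qed simp
  then have "card (H c) \<le> card (insert 1 ((\<lambda>(p, b). 2 * var_at p + b) ` ?P))"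
    by (intro card_mono subsetI) simp_all
  also have "\<dots> \<le> 1 + card ((\<lambda>(p, b). 2 * var_at p + b) ` ?P)"
    by (simp add: card_insert_if)
  also have "card ((\<lambda>(p, b). 2 * var_at p + b) ` ?P) \<le> card ?P"
    by (rule card_image_le) simp
  also have "card ?P = 2 * (hi j + 1 - lo j)"
    by simp
  also have "hi j + 1 - lo j \<le> bw + 1"
    using spread_le[OF j] by simp
  also have "bw + 1 \<le> W" by (rule less_imp_le[OF less_exp])
  also have "1 + 2 * W \<le> 3 * W" by simp
  finally show ?thesis by simp
qed

lemma runs_solve:
  assumes sel: "picker sel"
    and reg: "reg s = (\<lambda>x. if x = 0 then n else if x = 1 then m else if x = 2 then u else 0)"
    and arr: "arr s = (\<lambda>a i. if a = 0 \<and> i \<in> {1..n} then ord i else 0)"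
    and hset: "hset s = H" "H 0 = {1..m}" "\<And>h. u \<le> h \<Longrightarrow> H h = {}"
  shows "runs sel solve s (\<lambda>t s'. t \<le> 2000 * (2 ^ bw * (n + m + (\<Sum>j\<in>{1..m}. card (H j)) + 1)) \<and>
    reg s' 0 = of_bool (\<exists>a. \<forall>j\<in>{1..m}. solves a j))"
proof -
  define N where "N = (\<Sum>j\<in>{1..m}. card (H j))"
  have layout: "H = layout u H {1..m} (\<lambda>_. {}) (\<lambda>_. {})"
    using hset(2,3) by (auto simp: layout_def fun_eq_iff)
  have scan_time: "(\<Sum>j\<in>{1..m}. 1 + (\<Sum>c\<in>H j. 1 + card (H c))) \<le> m + 4 * W * N"
  proof -
    have "(\<Sum>j\<in>{1..m}. 1 + (\<Sum>c\<in>H j. 1 + card (H c))) \<le> (\<Sum>j\<in>{1..m}. 1 + (\<Sum>c\<in>H j. 4 * W))"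
    proof (intro sum_mono add_left_mono)
      fix j c assume "j \<in> {1..m}" "c \<in> H j"
      moreover have "1 \<le> W" by simp
      ultimately show "1 + card (H c) \<le> 4 * W" using card_clause_le[of j c] by linarith
    qed
    also have "\<dots> = m + (\<Sum>j\<in>{1..m}. card (H j) * (4 * W))"
      unfolding sum.distrib sum_constant by simp
    also have "\<dots> = m + 4 * W * N"
      unfolding N_def sum_distrib_right[symmetric] by simp
    finally show ?thesis .
  qed
  have sweep_time: "(\<Sum>j\<in>{1..m}. 1 + card (H j)) = m + N"
    unfolding N_def sum.distrib by simp
  \<comment> \<open>A common yardstick: every phase costs at most a constant times
    \<open>W * Z\<close>.\<close>
  define Z where "Z = n + m + N + 1"
  have W: "1 \<le> W" by simp
  have arr0: "arr s 0 = ord_array" by (simp add: arr)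
  have reg0: "reg s 0 = n" by (simp add: reg)
  obtain t1 s1 where e1: "exec sel invert s t1 s1"
    and 1: "t1 \<le> 30 * n + 20" "hset s1 = hset s" "\<forall>x. x \<noteq> 3 \<longrightarrow> reg s1 x = reg s x"
      "\<forall>a. a \<noteq> 1 \<longrightarrow> arr s1 a = arr s a" "\<forall>p\<le>n. arr s1 1 p = var_at p"
    using runs_invert[OF reg0 arr0, of sel] unfolding runs_def by blast
  have h1: "hset s1 = layout u H {1..m} (\<lambda>_. {}) (\<lambda>_. {})"
    using 1(2) hset(1) layout by simp
  have r1: "reg s1 0 = n" "reg s1 2 = u" "reg s1 8 = 0" "arr s1 0 = ord_array"
    using 1 by (simp_all add: reg arr0)
  obtain t2 s2 where e2: "exec sel scan s1 t2 s2"
    and 2: "t2 \<le> 80 * (1 + (\<Sum>j\<in>{1..m}. 1 + (\<Sum>c\<in>H j. 1 + card (H c))))" "arr s2 = arr s1"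
      "\<forall>x. x < 3 \<or> 8 < x \<longrightarrow> reg s2 x = reg s1 x" "reg s2 8 = bw"
      "\<forall>j\<in>{1..m}. hset s2 (j + u) = H j" "\<forall>j\<in>{1..m}. \<forall>c\<in>H j. hset s2 (c + u) = H c"
      "\<forall>e. hset s2 (u + u + e) = bucket e"
    using runs_scan[OF sel r1 h1] unfolding runs_def by blast
  obtain t3 s3 where e3: "exec sel powers s2 t3 s3"
    and 3: "t3 \<le> 30 * W + 20" "hset s3 = hset s2" "arr s3 = arr s2"
      "\<forall>x. x \<noteq> 3 \<and> x \<noteq> 9 \<and> x \<noteq> 10 \<longrightarrow> reg s3 x = reg s2 x" "reg s3 9 = W" "reg s3 10 = 2 ^ bw"
    using runs_powers[OF 2(4), of sel] unfolding runs_def by blast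
  \<comment> \<open>Arrays 2 and 3 and register 12 are still 0, in agreement with
    \<open>bad 0\<close> being false everywhere.\<close>
  have "ready 0 s3"
    unfolding ready_def using 1 2 3 by (simp add: reg arr)
  then obtain t4 s4 where e4: "exec sel sweep s3 t4 s4"
    and 4: "t4 \<le> 400 * W * (n + 1 + (\<Sum>j\<in>{1..m}. 1 + card (H j)))" "ready (n + 1) s4"
    using runs_sweep[OF sel] unfolding runs_def by blast
  obtain t5 s5 where e5: "exec sel answer s4 t5 s5"
    and 5: "t5 \<le> 30 * reg s4 9 + 20" "reg s5 0 = of_bool (\<exists>x<reg s4 9. arr s4 2 (reg s4 12 + x) = 0)"
    using runs_answer[OF refl refl, of sel s4] unfolding runs_def by blast
  have run: "exec sel solve s (t1 + (t2 + (t3 + (t4 + t5)))) s5"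
    unfolding solve_def 
    by (rule exec.Seq[OF e1 exec.Seq[OF e2 exec.Seq[OF e3 exec.Seq[OF e4 e5]]]])
  have r4: "reg s4 9 = W" "\<And>M. M < W \<Longrightarrow> arr s4 2 (reg s4 12 + M) = of_bool (bad (n + 1) M)"
    using 4(2) unfolding ready_def by blast+
  have "(\<exists>x<reg s4 9. arr s4 2 (reg s4 12 + x) = 0) \<longleftrightarrow> (\<exists>M<W. \<not> bad (n + 1) M)"
    unfolding r4(1) using r4(2) by (metis of_bool_eq_0_iff)
  then have result: "reg s5 0 = of_bool (\<exists>a. \<forall>j\<in>{1..m}. solves a j)"
    using 5(2) by (simp only: dynamic_programming)
  have Z: "x \<le> W * Z" if "x \<le> Z" for x
    using mult_le_mono[OF W that] by simp
  have "t1 \<le> 50 * Z" using 1(1) by (simp add: Z_def)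
  then have "t1 \<le> 50 * (W * Z)" using Z[of Z] by linarith
  moreover have "t2 \<le> 400 * (W * Z)"
  proof -
    have "t2 \<le> 80 * (1 + m) + 320 * (W * N)" using 2(1) scan_time by simp
    also have "\<dots> \<le> 80 * (W * Z) + 320 * (W * Z)"
      by (intro add_mono mult_le_mono2 Z) (simp_all add: Z_def)
    finally show ?thesis by linarith
  qed
  moreover have "t3 \<le> 50 * (W * Z)" "t5 \<le> 50 * (W * Z)"
  proof -
    have "W \<le> W * Z" by (simp add: Z_def)
    then show "t3 \<le> 50 * (W * Z)" "t5 \<le> 50 * (W * Z)"
      using 3(1) 5(1) W unfolding r4(1) by linarith+
  qed
  moreover have "t4 \<le> 400 * (W * Z)"
    using 4(1) unfolding sweep_time Z_def by (simp add: algebra_simps)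
  ultimately have "t1 + (t2 + (t3 + (t4 + t5))) \<le> 1000 * (W * Z)" by linarith
  \<comment> \<open>\<open>W\<close> is twice \<open>2 ^ bw\<close>, which turns 1000 into
    2000.\<close>
  then have time: "t1 + (t2 + (t3 + (t4 + t5))) \<le>
      2000 * (2 ^ bw * (n + m + (\<Sum>j\<in>{1..m}. card (H j)) + 1))"
    by (simp add: Z_def N_def)
  show ?thesis by (rule runsI[OF run]) (rule conjI[OF time result])
qed

end

section \<open>From the input to the clause system\<close>

lemma sum_of_bool_bit:
  "finite K \<Longrightarrow> (\<Sum>c\<in>K. of_bool (P c)) = (of_bool (odd (card {c \<in> K. P c})) :: bit)"
proof (induction K rule: finite_induct)
  case (insert x K)
  have "{c \<in> insert x K. P c} = (if P x then insert x {c \<in> K. P c} else {c \<in> K. P c})"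
    by auto
  then have "odd (card {c \<in> insert x K. P c}) \<longleftrightarrow> P x \<noteq> odd (card {c \<in> K. P c})"
    using insert.hyps by simp
  moreover have "of_bool p + of_bool q = (of_bool (p \<noteq> q) :: bit)" for p q
    by (cases p; cases q) simp_all
  ultimately show ?case
    unfolding sum.insert[OF insert.hyps] insert.IH by simp
qed simp

text \<open>The common core of both cases, with \<open>k\<close> bounding the number of clauses per
  polynomial. \<open>sum\<close> links the clauses to the value of the polynomial,
  \<open>vars\<close> links their literals to the bandwidth.\<close>

lemma solve_correct:
  assumes ord: "variable_order n ord" and sel: "picker sel" and input: "input_store summands n ps ord s"
    and sum: "\<And>p. p \<in> set ps \<Longrightarrow> (\<Sum>q\<in>summands p. q) = p"
    and vars: "\<And>p q. p \<in> set ps \<Longrightarrow> q \<in> summands p \<Longrightarrow> pvars q \<subseteq> pvars p"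
    and count: "\<And>p. p \<in> set ps \<Longrightarrow> card (summands p) \<le> k"
  shows "\<exists>t s'. exec sel solve s t s' \<and> reg s' 0 = of_bool (satisfiable n ps) \<and>
    t \<le> 2000 * (2 ^ bandwidth n ord ps * (n + length ps + length ps * k + 1))"
proof -
  define m where "m = length ps"
  define u where "u = reg s 2"
  define H where "H = hset s"
  define p where "p j = ps ! (j - 1)" for j
  have p: "p j \<in> set ps" if "j \<in> {1..m}" for j
    using that by (auto simp: p_def m_def)
  have set_ps: "set ps = p ` {1..m}"
  proof -
    have "q \<in> p ` {1..m}" if "q \<in> set ps" for q
    proof -
      from that obtain i where "i < m" "ps ! i = q" by (auto simp: m_def in_set_conv_nth)
      then show ?thesis by (intro image_eqI[of _ _ "Suc i"]) (auto simp: p_def)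
    qed
    with p show ?thesis by blast
  qed
  have in_store: "m < u" "reg s = (\<lambda>x. if x = 0 then n else if x = 1 then m else if x = 2 then u else 0)"
    "arr s = (\<lambda>a i. if a = 0 \<and> i \<in> {1..n} then ord i else 0)" "H 0 = {1..m}"
    "\<And>j. j \<in> {1..m} \<Longrightarrow> H j \<subseteq> {m<..<u}" "\<And>j. j \<in> {1..m} \<Longrightarrow> stores_sum n H (H j) (summands (p j))"
    "disjoint_family_on H {1..m}" "\<And>h. u \<le> h \<Longrightarrow> H h = {}"
    using input unfolding input_store_def Let_def m_def[symmetric] u_def[symmetric] H_def[symmetric] p_def
    by blast+
  obtain g where g: "\<And>j. j \<in> {1..m} \<Longrightarrow> bij_betw (g j) (H j) (summands (p j))"
    "\<And>j c. j \<in> {1..m} \<Longrightarrow> c \<in> H j \<Longrightarrow> stores_clause n (H c) (g j c)"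
    using in_store(6) unfolding stores_sum_def by metis
  have lit_codes: "finite (H c)" "\<forall>k\<in>H c. k = 1 \<or> k div 2 \<in> {1..n} \<inter> pvars (p j)"
    if "j \<in> {1..m}" "c \<in> H j" for j c
  proof -
    have "g j c \<in> summands (p j)" using g(1)[OF that(1)] that(2) by (rule bij_betw_apply)
    then have "pvars (g j c) \<subseteq> pvars (p j)" by (rule vars[OF p[OF that(1)]])
    from stores_clause_codes[OF g(2)[OF that] this]
    show "finite (H c)" "\<forall>k\<in>H c. k = 1 \<or> k div 2 \<in> {1..n} \<inter> pvars (p j)" by blast+
  qed
  interpret clause_system n m u ord H
  proof
    show "bij_betw ord {1..n} {1..n}" using ord by (simp add: variable_order_def)
    show "finite (H c) \<and> (\<forall>k\<in>H c. k = 1 \<or> k div 2 \<in> {1..n})" if "j \<in> {1..m}" "c \<in> H j" for j c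
      using lit_codes[OF that] by blast
  qed (fact in_store)+
  have solves: "peval a (p j) = 0 \<longleftrightarrow> solves (\<lambda>i. a i = 1) j" if j: "j \<in> {1..m}" for a j
  proof -
    have "peval a (p j) = (\<Sum>q\<in>summands (p j). peval a q)"
      unfolding peval_sum[symmetric] sum[OF p[OF j]] ..
    also have "\<dots> = (\<Sum>c\<in>H j. peval a (g j c))"
      by (rule sum.reindex_bij_betw[OF g(1)[OF j], symmetric])
    also have "\<dots> = (\<Sum>c\<in>H j. of_bool (holds (\<lambda>i. a i = 1) (H c)))"
      by (rule sum.cong[OF refl]) (rule peval_stores_clause[OF g(2)[OF j]])
    also have "\<dots> = of_bool (odd (card {c \<in> H j. holds (\<lambda>i. a i = 1) (H c)}))"
      by (rule sum_of_bool_bit[OF finite_clauses[OF j]])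
    finally show ?thesis
      by (simp add: solves_def)
  qed
  have sat: "satisfiable n ps \<longleftrightarrow> (\<exists>a. \<forall>j\<in>{1..m}. solves a j)"
  proof
    assume "satisfiable n ps"
    then obtain a where "\<forall>q\<in>set ps. peval a q = 0" unfolding satisfiable_def by blast
    with p solves have "\<forall>j\<in>{1..m}. solves (\<lambda>i. a i = 1) j" by blast
    then show "\<exists>a. \<forall>j\<in>{1..m}. solves a j" by (rule exI[of _ "\<lambda>i. a i = 1"])
  next
    assume "\<exists>a. \<forall>j\<in>{1..m}. solves a j"
    then obtain a where a: "\<And>j. j \<in> {1..m} \<Longrightarrow> solves a j" by blast
    \<comment> \<open>\<open>satisfiable\<close> asks for an extensional assignment, hence the
      restriction; equations look only at variables in \<open>{1..n}\<close>.\<close>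
    define b :: "nat \<Rightarrow> bit" where "b = restrict (\<lambda>i. of_bool (a i)) {1..n}"
    have "peval b (p j) = 0" if j: "j \<in> {1..m}" for j
    proof -
      have "solves (\<lambda>i. b i = 1) j \<longleftrightarrow> solves a j"
        by (rule solves_cong[OF j]) (simp add: b_def)
      with a[OF j] show ?thesis by (simp only: solves[OF j])
    qed
    moreover have "b \<in> {1..n} \<rightarrow>\<^sub>E UNIV" by (simp add: b_def)
    ultimately show "satisfiable n ps"
      unfolding satisfiable_def set_ps by blast
  qed
  \<comment> \<open>By \<open>lit_codes\<close> every stored literal belongs to a variable of its
    polynomial, so the measured spread cannot exceed the true one.\<close>
  have bw: "bw \<le> bandwidth n ord ps"
  proof -
    have spread: "hi j - lo j \<le> bandwidth n ord ps" if j: "j \<in> {1..m}" for j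
    proof (cases "lits j = {}")
      case True
      \<comment> \<open>The defaults give \<open>0 - (n + 1)\<close>, which is 0 on natural
        numbers.\<close>
      then show ?thesis by (simp add: hi_def lo_def)
    next
      case False
      let ?V = "ord ` pvars (p j)"
      have fin: "finite ?V" by (simp add: pvars_def)
      have sub: "place ` lits j \<subseteq> ?V"
        using lit_codes(2)[OF j] by (fastforce simp: lits_def place_def)
      then have ne: "pvars (p j) \<noteq> {}" using False by blast
      have "hi j \<le> Max ?V"
        using Max_mono[OF sub _ fin] False finite_lits[OF j] by (simp add: hi_def)
      moreover have "Min ?V \<le> lo j"
      proof -
        obtain l where l: "l \<in> lits j" using False by blast
        then have "Min ?V \<le> place l" using sub fin by (intro Min_le) auto
        with place_range[OF j l] have "Min ?V \<le> n + 1" by simp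
        moreover have "Min ?V \<le> Min (place ` lits j)"
          using Min_antimono[OF sub _ fin] False by simp
        ultimately show ?thesis
          using False finite_lits[OF j] by (simp add: lo_def)
      qed
      ultimately have "hi j - lo j \<le> pi_max n ord (p j) - pi_min n ord (p j)"
        using ne by (simp add: pi_max_def pi_min_def)
      also have "\<dots> \<le> bandwidth n ord ps"
        unfolding bandwidth_def using p[OF j] by (intro Max_ge) auto
      finally show ?thesis .
    qed
    then show ?thesis by (simp add: bw_def)
  qed
  have "(\<Sum>j\<in>{1..m}. card (H j)) \<le> m * k"
  proof -
    have "card (H j) \<le> k" if j: "j \<in> {1..m}" for j
      using count[OF p[OF j]] bij_betw_same_card[OF g(1)[OF j]] by simp
    then show ?thesis using sum_bounded_above[of "{1..m}" "\<lambda>j. card (H j)" k] by simp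
  qed
  then have time: "2000 * (2 ^ bw * (n + m + (\<Sum>j\<in>{1..m}. card (H j)) + 1)) \<le>
      2000 * (2 ^ bandwidth n ord ps * (n + m + m * k + 1))"
    using bw by (intro mult_le_mono2 mult_le_mono power_increasing) simp_all
  obtain t s' where "exec sel solve s t s'"
    "t \<le> 2000 * (2 ^ bw * (n + m + (\<Sum>j\<in>{1..m}. card (H j)) + 1))"
    "reg s' 0 = of_bool (\<exists>a. \<forall>j\<in>{1..m}. solves a j)"
    using runs_solve[OF sel in_store(2,3) H_def[symmetric] in_store(4,8)] unfolding runs_def by blast
  with order_trans[OF _ time] show ?thesis
    unfolding sat m_def[symmetric] by blast
qed

theorem corollary3p3:
  shows "decidable_in_time bmq_sat monomial_summands (\<lambda>B m n. 2 ^ B * (m + n) * n\<^sup>2) \<and>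
         decidable_in_time cnf_sat clause_summands (\<lambda>B m n. 2 ^ B * (m + n))"
proof
  show "decidable_in_time bmq_sat monomial_summands (\<lambda>B m n. 2 ^ B * (m + n) * n\<^sup>2)"
    unfolding decidable_in_time_def
  proof (rule exI[of _ solve], rule exI[of _ 8000], intro allI impI, elim conjE)
    fix n ps ord sel s
    assume n: "1 \<le> n" and bmq: "bmq_sat n ps" and *: "variable_order n ord" "picker sel"
      "input_store monomial_summands n ps ord s"
    have count: "card (monomial_summands p) \<le> 2 * n\<^sup>2" if "p \<in> set ps" for p
    proof (rule card_monomial_summands[OF n])
      show "p \<in> BP n" using bmq that by (auto simp: bmq_sat_def)
      have "deg p \<le> sys_degree ps"
        unfolding sys_degree_def using that by (intro Max_ge) auto
      then show "deg p \<le> 2" using bmq by (simp add: bmq_sat_def)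
    qed
    have vars: "pvars q \<subseteq> pvars p" if "q \<in> monomial_summands p" for p q
      using that pvars_mon by (auto simp: monomial_summands_def)
    obtain t s' where run: "exec sel solve s t s'" "reg s' 0 = of_bool (satisfiable n ps)"
      "t \<le> 2000 * (2 ^ bandwidth n ord ps * (n + length ps + length ps * (2 * n\<^sup>2) + 1))"
      using solve_correct[OF * sum_monomial_summands vars count] by blast
    \<comment> \<open>With m equations and \<open>n \<ge> 1\<close>, \<open>m + 2 * m * n^2\<close>
      is at most \<open>3 * m * n^2\<close>, and \<open>n + 1\<close> is at most
      \<open>2 * n * n^2\<close>; the factor 4 makes 8000 out of 2000.\<close>
    have "n + length ps + length ps * (2 * n\<^sup>2) + 1 \<le> 4 * ((length ps + n) * n\<^sup>2)"
    proof -
      have "x * 1 \<le> x * n\<^sup>2" for x using n by (intro mult_le_mono2) simp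
      from this[of n] this[of "length ps"]
      have "n \<le> n * n\<^sup>2" "length ps \<le> length ps * n\<^sup>2" by simp_all
      moreover have "length ps * (2 * n\<^sup>2) = 2 * (length ps * n\<^sup>2)" by simp
      moreover have "4 * ((length ps + n) * n\<^sup>2) = 4 * (length ps * n\<^sup>2) + 4 * (n * n\<^sup>2)"
        by (simp only: distrib_right distrib_left)
      ultimately show ?thesis using n by linarith
    qed
    then have "2000 * (2 ^ bandwidth n ord ps * (n + length ps + length ps * (2 * n\<^sup>2) + 1))
        \<le> 2000 * (2 ^ bandwidth n ord ps * (4 * ((length ps + n) * n\<^sup>2)))"
      by (intro mult_le_mono2)
    with run show "\<exists>t s'. exec sel solve s t s' \<and> reg s' 0 = of_bool (satisfiable n ps) \<and>
        t \<le> 8000 * (2 ^ bandwidth n ord ps * (length ps + n) * n\<^sup>2)"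
      by (intro exI[of _ t] exI[of _ s']) (simp add: mult.assoc)
  qed
next
  show "decidable_in_time cnf_sat clause_summands (\<lambda>B m n. 2 ^ B * (m + n))"
    unfolding decidable_in_time_def
  proof (rule exI[of _ solve], rule exI[of _ 4000], intro allI impI, elim conjE)
    fix n ps ord sel s
    assume n: "1 \<le> n" and *: "variable_order n ord" "picker sel" "input_store clause_summands n ps ord s"
    obtain t s' where run: "exec sel solve s t s'" "reg s' 0 = of_bool (satisfiable n ps)"
      "t \<le> 2000 * (2 ^ bandwidth n ord ps * (n + length ps + length ps * 1 + 1))"
      using solve_correct[OF *, of 1] by (auto simp: clause_summands_def)
    \<comment> \<open>One clause per equation gives \<open>n + 2 * m + 1\<close> for m equations,
      and \<open>1 \<le> n\<close> bounds this by twice \<open>m + n\<close>.\<close>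
    have "2000 * (2 ^ bandwidth n ord ps * (n + length ps + length ps * 1 + 1))
        \<le> 2000 * (2 ^ bandwidth n ord ps * (2 * (length ps + n)))"
      using n by (intro mult_le_mono2) simp
    also have "\<dots> = 4000 * (2 ^ bandwidth n ord ps * (length ps + n))"
      by (simp only: mult.assoc mult.left_commute[of _ 2])
    finally have "2000 * (2 ^ bandwidth n ord ps * (n + length ps + length ps * 1 + 1))
        \<le> 4000 * (2 ^ bandwidth n ord ps * (length ps + n))" .
    with run show "\<exists>t s'. exec sel solve s t s' \<and> reg s' 0 = of_bool (satisfiable n ps) \<and>
        t \<le> 4000 * (2 ^ bandwidth n ord ps * (length ps + n))"
      by (intro exI[of _ t] exI[of _ s'] conjI) (assumption, assumption, rule order_trans)
  qed
qed

end
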